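(* Assume Dickson's conjecture. Then $T_{\Pr}$ is locally FHP. In fact, for every partitioned formula $\varphi(x,y)$ in the language of $T_{\Pr}$ there exists $d=d(\varphi)$ such that, letting $s:=|y|$, for every $\alpha>0$ there exists $\beta=\beta(\varphi,\alpha)>0$ with the following property: for any $n\in\mathbb{N}$ and tuples $c_i=(c_{i,j}:j\in[s])$ from $\mathbb{Z}$, $i\in[n]$, such that for each fixed $j\in[s]$ we have $\operatorname{tp}(c_{i,j})=\operatorname{tp}(c_{i',j})$ for all $i,i'\in[n]$, if $$\Big|\Big\{I\in\tbinom{[n]}{d}:\bigcap_{i\in I}\varphi(\mathbb{Z},c_i)\neq\emptyset\Big\}\Big|\geq\alpha\binom nd,$$ then there is $J\subseteq[n]$ with $|J|\geq\beta n$ and $\bigcap_{i\in J}\varphi(\mathbb{Z},c_i)\neq\emptyset$.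
   Context: $\Pr\subseteq\mathbb{Z}$ is the set of primes and their additive inverses. $T_{\Pr}$ is the complete theory of $(\mathbb{Z},+,-,0,1,\Pr,\Pr_n,P_n:2\leq n<\omega)$, where $P_n(x)\iff x\equiv0\pmod n$ and $\Pr_n(x)\iff P_n(x)\wedge\Pr(x/n)$. Types $\operatorname{tp}(c)$ are complete types over $\emptyset$ in this structure. Dickson's conjecture: for every $k\geq1$ and linear polynomials $f_i(x)=a_ix+b_i$ ($i<k$) with $a_i,b_i$ non-negative integers and $a_i\geq1$, if there is no integer $n\geq 2$ dividing $\prod_{i<k}f_i(s)$ for every non-negative integer $s$, then there are infinitely many natural numbers $m$ with $f_i(m)$ prime for all $i<k$. FHP: for a tuple $\bar S=(S_1,\dots,S_n)$ of sets let $\mathrm{Cons}_k(\bar S)=\{J\subseteq[n]:|J|=k,\bigcap_{i\in J}S_i\neq\emptyset\}$; a family $\mathcal{F}$ satisfies $\mathrm{FHP}_k$ if for every $\alpha>0$ there is $\beta>0$ such that every tuple $\bar S$ of $n$ members of $\mathcal{F}$ (repetitions allowed) with $|\mathrm{Cons}_k(\bar S)|\geq\alpha\binom nk$ has $J\subseteq[n]$, $|J|\geq\beta n$, with $\bigcap_{i\in J}S_i\neq\emptyset$. A theory $T$ is locally FHP if for every partitioned formula $\varphi(x,y)$ there is $k$ such that for every complete type $q\in S_y(\emptyset)$ the family $\{\varphi(\mathbb{M},b):b\models q\}$ (in a monster model $\mathbb{M}$) satisfies $\mathrm{FHP}_k$.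
   Formalization: In the definition of FHP_k only tuples of length n ≥ k are considered; for n < k the hypothesis would read 0 ≥ 0, and then the formula "x = y and y ≠ 0" would have no k serving every type q, so local FHP would fail trivially. *)

theory Defs
  imports Complex_Main "HOL-Computational_Algebra.Primes"
begin

section \<open>The language of $(\mathbb{Z},+,-,0,1,\Pr,\Pr_n,P_n : 2 \le n < \omega)$\<close>

datatype tm =
    Var nat
  | Zero
  | One
  | Add tm tm
  | Minus tm

text \<open>
  The symbols $P_n$ and $\Pr_n$ exist for $n \ge 2$ only. To make every element of the datatype a
  formula, the subscript is shifted: \<open>Mult k\<close> is the symbol $P_{k+2}$ and \<open>MultPrime k\<close>
  is the symbol $\Pr_{k+2}$.
\<close>

datatype fm =
    Eq tm tm
  | Prime tm
  | MultPrime nat tm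
  | Mult nat tm
  | Neg fm
  | Conj fm fm
  | Exi nat fm

text \<open>The universe of a structure is the whole type \<^typ>\<open>'a\<close>.\<close>

record 'a struct =
  Zero_I :: 'a
  One_I :: 'a
  Add_I :: "'a \<Rightarrow> 'a \<Rightarrow> 'a"
  Minus_I :: "'a \<Rightarrow> 'a"
  Prime_I :: "'a \<Rightarrow> bool"
  MultPrime_I :: "nat \<Rightarrow> 'a \<Rightarrow> bool"
  Mult_I :: "nat \<Rightarrow> 'a \<Rightarrow> bool"

primrec tm_val :: "'a struct \<Rightarrow> (nat \<Rightarrow> 'a) \<Rightarrow> tm \<Rightarrow> 'a" where
  "tm_val M v (Var i) = v i"
| "tm_val M v Zero = Zero_I M"
| "tm_val M v One = One_I M"
| "tm_val M v (Add t u) = Add_I M (tm_val M v t) (tm_val M v u)"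
| "tm_val M v (Minus t) = Minus_I M (tm_val M v t)"

primrec sat :: "'a struct \<Rightarrow> (nat \<Rightarrow> 'a) \<Rightarrow> fm \<Rightarrow> bool" where
  "sat M v (Eq t u) \<longleftrightarrow> tm_val M v t = tm_val M v u"
| "sat M v (Prime t) \<longleftrightarrow> Prime_I M (tm_val M v t)"
| "sat M v (MultPrime k t) \<longleftrightarrow> MultPrime_I M k (tm_val M v t)"
| "sat M v (Mult k t) \<longleftrightarrow> Mult_I M k (tm_val M v t)"
| "sat M v (Neg \<phi>) \<longleftrightarrow> \<not> sat M v \<phi>"
| "sat M v (Conj \<phi> \<psi>) \<longleftrightarrow> sat M v \<phi> \<and> sat M v \<psi>"
| "sat M v (Exi i \<phi>) \<longleftrightarrow> (\<exists>a. sat M (v(i := a)) \<phi>)"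

primrec tm_vars :: "tm \<Rightarrow> nat set" where
  "tm_vars (Var i) = {i}"
| "tm_vars Zero = {}"
| "tm_vars One = {}"
| "tm_vars (Add t u) = tm_vars t \<union> tm_vars u"
| "tm_vars (Minus t) = tm_vars t"

primrec free_vars :: "fm \<Rightarrow> nat set" where
  "free_vars (Eq t u) = tm_vars t \<union> tm_vars u"
| "free_vars (Prime t) = tm_vars t"
| "free_vars (MultPrime k t) = tm_vars t"
| "free_vars (Mult k t) = tm_vars t"
| "free_vars (Neg \<phi>) = free_vars \<phi>"
| "free_vars (Conj \<phi> \<psi>) = free_vars \<phi> \<union> free_vars \<psi>"
| "free_vars (Exi i \<phi>) = free_vars \<phi> - {i}"

definition models :: "'a struct \<Rightarrow> fm set \<Rightarrow> bool" where
  "models M T \<longleftrightarrow> (\<forall>\<phi>\<in>T. \<forall>v. sat M v \<phi>)"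


section \<open>The structure on the integers and its complete theory\<close>

definition Pr :: "int set" where
  "Pr = {x. prime x \<or> prime (- x)}"

definition int_structure :: "int struct" where
  "int_structure =
    \<lparr> Zero_I = 0, One_I = 1, Add_I = (+), Minus_I = uminus,
      Prime_I = (\<lambda>x. x \<in> Pr),
      MultPrime_I = (\<lambda>k x. (int k + 2) dvd x \<and> x div (int k + 2) \<in> Pr),
      Mult_I = (\<lambda>k x. (int k + 2) dvd x) \<rparr>"

definition T_Pr :: "fm set" where
  "T_Pr = {\<phi>. free_vars \<phi> = {} \<and> (\<forall>v. sat int_structure v \<phi>)}"


section \<open>Types and partitioned formulas\<close>

text \<open>
  A finite tuple \<open>b\<close> is a list, assigned to the variables \<open>0, \<dots>, length b - 1\<close>; values of
  \<open>(!) b\<close> beyond the length are never inspected, because the free variables are bounded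
  wherever this is used.
\<close>

definition tp :: "'a struct \<Rightarrow> 'a list \<Rightarrow> fm set" where
  "tp M b = {\<phi>. free_vars \<phi> \<subseteq> {..<length b} \<and> sat M ((!) b) \<phi>}"

text \<open>Complete types over the empty set in \<open>s\<close> variables, relative to the complete theory of
  \<open>M\<close>; they need not be realised in \<open>M\<close>.\<close>

definition complete_types :: "'a struct \<Rightarrow> nat \<Rightarrow> fm set set" where
  "complete_types M s =
    {q. (\<forall>\<phi>\<in>q. free_vars \<phi> \<subseteq> {..<s})
      \<and> (\<forall>F. finite F \<longrightarrow> F \<subseteq> q \<longrightarrow> (\<exists>b. length b = s \<and> (\<forall>\<phi>\<in>F. sat M ((!) b) \<phi>)))
      \<and> (\<forall>\<phi>. free_vars \<phi> \<subseteq> {..<s} \<longrightarrow> \<phi> \<in> q \<or> Neg \<phi> \<in> q)}"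

definition realizes :: "'a struct \<Rightarrow> 'a list \<Rightarrow> fm set \<Rightarrow> bool" where
  "realizes M b q \<longleftrightarrow> (\<forall>\<phi>\<in>q. sat M ((!) b) \<phi>)"

text \<open>
  A partitioned formula $\varphi(x,y)$ with $|x| = r$ and $|y| = s$: after renaming, \<open>x\<close> consists
  of the variables \<open>0, \<dots>, r - 1\<close> and \<open>y\<close> of the variables \<open>r, \<dots>, r + s - 1\<close>.
\<close>

definition partitioned :: "fm \<Rightarrow> nat \<Rightarrow> nat \<Rightarrow> bool" where
  "partitioned \<phi> r s \<longleftrightarrow> free_vars \<phi> \<subseteq> {..<r + s}"

text \<open>$\varphi(M,b)$\<close>

definition def_set :: "'a struct \<Rightarrow> fm \<Rightarrow> nat \<Rightarrow> 'a list \<Rightarrow> 'a list set" where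
  "def_set M \<phi> r b = {a. length a = r \<and> sat M ((!) (a @ b)) \<phi>}"


section \<open>Monster models\<close>

text \<open>A formula with parameters is a pair \<open>(\<phi>, e)\<close>, in which \<open>e\<close> gives the values of the
  parameters; the variable of the type is \<open>0\<close>.\<close>

definition saturated :: "'a rel \<Rightarrow> 'a struct \<Rightarrow> bool" where
  "saturated \<kappa> M \<longleftrightarrow>
    (\<forall>A p. (card_of A, \<kappa>) \<in> ordLess
      \<longrightarrow> (\<forall>(\<phi>, e)\<in>p. e ` (free_vars \<phi> - {0}) \<subseteq> A)
      \<longrightarrow> (\<forall>F. finite F \<longrightarrow> F \<subseteq> p \<longrightarrow> (\<exists>a. \<forall>(\<phi>, e)\<in>F. sat M (e(0 := a)) \<phi>))
      \<longrightarrow> (\<exists>a. \<forall>(\<phi>, e)\<in>p. sat M (e(0 := a)) \<phi>))"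

definition partial_elementary :: "'a struct \<Rightarrow> 'a set \<Rightarrow> ('a \<Rightarrow> 'a) \<Rightarrow> bool" where
  "partial_elementary M A f \<longleftrightarrow>
    (\<forall>\<phi> v. range v \<subseteq> A \<longrightarrow> (sat M v \<phi> \<longleftrightarrow> sat M (f \<circ> v) \<phi>))"

definition automorphism :: "'a struct \<Rightarrow> ('a \<Rightarrow> 'a) \<Rightarrow> bool" where
  "automorphism M g \<longleftrightarrow> bij g
    \<and> g (Zero_I M) = Zero_I M \<and> g (One_I M) = One_I M
    \<and> (\<forall>x y. g (Add_I M x y) = Add_I M (g x) (g y))
    \<and> (\<forall>x. g (Minus_I M x) = Minus_I M (g x))
    \<and> (\<forall>x. Prime_I M (g x) \<longleftrightarrow> Prime_I M x)
    \<and> (\<forall>k x. MultPrime_I M k (g x) \<longleftrightarrow> MultPrime_I M k x)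
    \<and> (\<forall>k x. Mult_I M k (g x) \<longleftrightarrow> Mult_I M k x)"

definition strongly_homogeneous :: "'a rel \<Rightarrow> 'a struct \<Rightarrow> bool" where
  "strongly_homogeneous \<kappa> M \<longleftrightarrow>
    (\<forall>A f. (card_of A, \<kappa>) \<in> ordLess \<longrightarrow> partial_elementary M A f
      \<longrightarrow> (\<exists>g. automorphism M g \<and> (\<forall>a\<in>A. g a = f a)))"

text \<open>
  A monster model is $\kappa$-saturated and strongly $\kappa$-homogeneous for some $\kappa > |T|$.
  The language is countable, so this means that $\kappa$ is uncountable. Since
  $\kappa$-saturation of an infinite model implies that its size is at least $\kappa$, it is no
  restriction to represent $\kappa$ by a well-order on (a subset of) the universe.
\<close>

definition monster_model :: "fm set \<Rightarrow> 'a struct \<Rightarrow> bool" where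
  "monster_model T M \<longleftrightarrow> models M T \<and>
    (\<exists>\<kappa> :: 'a rel. Card_order \<kappa> \<and> (natLeq, \<kappa>) \<in> ordLess
      \<and> saturated \<kappa> M \<and> strongly_homogeneous \<kappa> M)"


section \<open>The fractional Helly property\<close>

definition Cons_sets :: "nat \<Rightarrow> nat \<Rightarrow> (nat \<Rightarrow> 'b set) \<Rightarrow> nat set set" where
  "Cons_sets k n S = {J. J \<subseteq> {1..n} \<and> card J = k \<and> (\<Inter>i\<in>J. S i) \<noteq> {}}"

text \<open>
  As usual for fractional Helly properties, only tuples of length at least \<open>k\<close> are considered.
  For $n < k$ the hypothesis $|\mathrm{Cons}_k| \ge \alpha \binom{n}{k} = 0$ would be void, and no
  family containing the empty set could satisfy the property for any $k \ge 2$.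
\<close>

definition FHP :: "nat \<Rightarrow> 'b set set \<Rightarrow> bool" where
  "FHP k \<F> \<longleftrightarrow>
    (\<forall>\<alpha>::real. \<alpha> > 0 \<longrightarrow> (\<exists>\<beta>::real. \<beta> > 0 \<and>
      (\<forall>n S. n \<ge> k \<longrightarrow> (\<forall>i\<in>{1..n}. S i \<in> \<F>)
        \<longrightarrow> real (card (Cons_sets k n S)) \<ge> \<alpha> * real (n choose k)
        \<longrightarrow> (\<exists>J\<subseteq>{1..n}. real (card J) \<ge> \<beta> * real n \<and> (\<Inter>i\<in>J. S i) \<noteq> {}))))"

text \<open>
  The argument of type \<^typ>\<open>'a itself\<close> fixes the universe in which monster models are
  taken; types too small to carry one impose no condition, so the property is meant for arbitrary \<^typ>\<open>'a\<close>.
\<close>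

definition locally_FHP :: "'a itself \<Rightarrow> fm set \<Rightarrow> bool" where
  "locally_FHP U T \<longleftrightarrow>
    (\<forall>\<phi> r s. partitioned \<phi> r s \<longrightarrow>
      (\<exists>k. \<forall>M :: 'a struct. monster_model T M \<longrightarrow>
        (\<forall>q \<in> complete_types M s.
          FHP k {def_set M \<phi> r b | b. length b = s \<and> realizes M b q})))"


section \<open>Dickson's conjecture\<close>

definition Dickson_conjecture :: bool where
  "Dickson_conjecture \<longleftrightarrow>
    (\<forall>(k::nat) (a :: nat \<Rightarrow> nat) (b :: nat \<Rightarrow> nat).
      k \<ge> 1 \<longrightarrow> (\<forall>i<k. a i \<ge> 1)
      \<longrightarrow> \<not> (\<exists>n\<ge>2. \<forall>s. n dvd (\<Prod>i<k. a i * s + b i))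
      \<longrightarrow> infinite {m. \<forall>i<k. prime (a i * m + b i)})"

end

theory Submission
  imports Defs "HOL-Library.FuncSet"
begin

text \<open>
  The second claim is trivial, as all tuples \<open>c i\<close> coincide: every integer is definable. For the
  first one, finitely many properties of realisations of a type in a model are transferred to
  parameters in \<open>\<int>\<close> that are congruent modulo any prescribed number \<open>Q\<close>.

  Dickson's conjecture implies that a definable relation on \<open>\<int>\<close> depends only on the patterns
  (small value, residue, being a prime times \<open>u \<le> K\<close>) of the values of finitely many affine forms.
  Let \<open>k\<close> exceed the number of patterns. In a consistent \<open>k\<close>-subset two indices have the same
  pattern, so one index \<open>i0\<close> shares a pattern with a positive proportion of the others. From one common
  point \<open>a\<close> one moves by \<open>a + D * w * v\<close>, where \<open>v\<close> is generic among the directions preserving the values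
  prescribed by the pattern. After passing to a subset of positive proportion no two indices make
  contradictory demands on the same form in \<open>w\<close>. A prime \<open>p\<close> gives no local obstruction: it is small and
  divides \<open>D\<close>, or it divides \<open>Q\<close> and hence the number of different forms modulo \<open>p\<close> is
  bounded, or it exceeds the total number of forms. So Dickson's conjecture provides \<open>w\<close>.
\<close>

section \<open>Dickson's conjecture over the integers\<close>

text \<open>A consistent set provides a point for its own members only, and different sets provide
  unrelated points; the index \<open>i0\<close> is the link between them. At each of the points
  used, \<open>c i0\<close> produces the same pattern, hence the same small values, so any two of
  these points differ by a vector along which the forms with prescribed values do not move.
  Genericity of \<open>v\<close> means that proportionality of two forms along \<open>v\<close> is
  proportionality on all such vectors.

  The obstacle is a form that must be \<open>u\<close> times a prime for one index while a
  proportional form must not be such a multiple for another index. Within one index the known point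
  rules this out; between two indices nothing does. The kinds of conflict are finite in number,
  depending on the formula only, and each kind is removed at the price of a factor 4. So the
  proportion lost does not depend on the number of parameters, while the modulus \<open>Q\<close>
  may grow with that number, because equality of types gives congruence modulo every
  integer.\<close>

lemma Pr_minus [simp]: "- x \<in> Pr \<longleftrightarrow> x \<in> Pr"
  by (auto simp: Pr_def)

lemma Pr_iff_prime_abs: "x \<in> Pr \<longleftrightarrow> prime \<bar>x\<bar>"
  unfolding Pr_def by (auto simp: abs_if dest: prime_gt_0_int)

lemma prime_int_natD: "prime (p::int) \<Longrightarrow> \<exists>q::nat. prime q \<and> p = int q"
  by (metis nonneg_int_cases prime_int_nat_transfer nat_int)

lemma not_prime_dvd_Pr:
  assumes "x \<in> Pr" "prime p" "p < \<bar>x\<bar>"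
  shows "\<not> p dvd (x::int)"
  using assms primes_dvd_imp_eq[of p "\<bar>x\<bar>"] by (auto simp: Pr_iff_prime_abs)

lemma linear_congruence_solvable:
  fixes a b p :: int
  assumes "prime p" "\<not> p dvd a"
  shows "\<exists>r. p dvd a * r + b"
proof -
  have "coprime a p"
    using assms by (metis coprime_commute prime_imp_coprime)
  then obtain u v where uv: "u * a + v * p = 1"
    by (metis bezout_int coprime_imp_gcd_eq_1)
  have "a * (- b * u) + b = b * (1 - u * a)"
    by (simp add: algebra_simps)
  also have "\<dots> = p * (b * v)"
    using uv by (simp add: algebra_simps flip: uv)
  finally show ?thesis
    by (metis dvd_triv_left)
qed

text \<open>The conjecture speaks about non-negative coefficients. Multiplying a form by the sign of
  its slope keeps membership in \<open>Pr\<close>, and the substitution \<open>w = m + S\<close>,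
  with \<open>S\<close> at least every \<open>\<bar>b\<bar>\<close>, makes the constant term
  non-negative. \<open>S \<ge> \<bar>L\<bar>\<close> yields the lower bound on
  \<open>w\<close>.\<close>

lemma Dickson_int:
  fixes F :: "(int \<times> int) set"
  assumes Dickson: Dickson_conjecture and fin: "finite F"
    and nz: "\<And>a b. (a, b) \<in> F \<Longrightarrow> a \<noteq> 0"
    and loc: "\<And>p. prime p \<Longrightarrow> \<exists>w. \<forall>(a, b) \<in> F. \<not> p dvd a * w + b"
  shows "\<exists>w\<ge>L. \<forall>(a, b) \<in> F. a * w + b \<in> Pr"
proof (cases "F = {}")
  case False
  obtain h where h: "bij_betw h {..<card F} F"
    using ex_bij_betw_nat_finite[OF fin] by (auto simp: atLeast0LessThan)
  define S where "S = \<bar>L\<bar> + (\<Sum>(a, b)\<in>F. \<bar>b\<bar>)"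
  define A where "A i = nat \<bar>fst (h i)\<bar>" for i
  define B where "B i = nat (\<bar>fst (h i)\<bar> * S + sgn (fst (h i)) * snd (h i))" for i
  have hF: "h i \<in> F" if "i < card F" for i
    using h that by (auto simp: bij_betw_def)
  have S: "\<bar>b\<bar> \<le> S" if "(a, b) \<in> F" for a b
  proof -
    have "\<bar>b\<bar> \<le> (\<Sum>(a, b)\<in>F. \<bar>b\<bar>)"
      using member_le_sum[OF that, of "\<lambda>(a, b). \<bar>b\<bar>"] fin by auto
    then show ?thesis by (simp add: S_def)
  qed
  have val: "int (A i * m + B i) = sgn (fst (h i)) * (fst (h i) * (int m + S) + snd (h i))"
    if "i < card F" for i m
  proof -
    obtain a b where ab: "h i = (a, b)" by force
    have "a \<noteq> 0" using nz hF[OF that] ab by auto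
    have "\<bar>sgn a * b\<bar> \<le> S" using S hF[OF that] ab \<open>a \<noteq> 0\<close> by (simp add: abs_mult)
    moreover have "S \<le> \<bar>a\<bar> * S"
      using \<open>a \<noteq> 0\<close> \<open>\<bar>sgn a * b\<bar> \<le> S\<close> mult_right_mono[of 1 "\<bar>a\<bar>" S] by linarith
    ultimately have "\<bar>a\<bar> * S + sgn a * b \<ge> 0" by linarith
    then show ?thesis by (simp add: A_def B_def ab algebra_simps mult_sgn_abs flip: abs_sgn)
  qed
  have "\<not> (\<exists>n\<ge>2. \<forall>s. n dvd (\<Prod>i<card F. A i * s + B i))"
  proof
    assume "\<exists>n\<ge>2. \<forall>s. n dvd (\<Prod>i<card F. A i * s + B i)"
    then obtain n where n: "n \<ge> 2" "\<And>s. n dvd (\<Prod>i<card F. A i * s + B i)" by auto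
    obtain p where p: "prime p" "p dvd n" using prime_factor_nat[of n] n by auto
    obtain w where w: "\<forall>(a, b) \<in> F. \<not> int p dvd a * w + b"
      using loc[of "int p"] p by auto
    \<comment> \<open>The local witness \<open>w\<close> is moved back through the substitution;
      reduction modulo \<open>p\<close> turns it into a natural number.\<close>
    define s where "s = nat ((w - S) mod int p)"
    have s: "int s = (w - S) mod int p"
      using p by (simp add: s_def prime_gt_0_nat)
    have "p dvd (\<Prod>i<card F. A i * s + B i)"
      using n p dvd_trans by blast
    then obtain i where i: "i < card F" "p dvd A i * s + B i"
      using p by (auto simp: prime_dvd_prod_iff)
    obtain a b where ab: "h i = (a, b)" by force
    have "a \<noteq> 0" using nz hF[OF i(1)] ab by auto
    have "int p dvd sgn a * (a * (int s + S) + b)"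
      using i(2) val[OF i(1), of s] ab by (metis fst_conv snd_conv int_dvd_int_iff)
    then have "int p dvd a * (int s + S) + b"
      using \<open>a \<noteq> 0\<close> dvd_mult[of "int p" "sgn a * (a * (int s + S) + b)" "sgn a"]
      by (simp flip: mult.assoc)
    moreover have "int p dvd w - (int s + S)"
      using dvd_minus_mod[of "int p" "w - S"] by (simp add: s algebra_simps)
    ultimately have "int p dvd (a * (int s + S) + b) + a * (w - (int s + S))"
      by (meson dvd_add dvd_mult)
    then have "int p dvd a * w + b" by (simp add: algebra_simps)
    with w hF[OF i(1)] ab show False by auto
  qed
  moreover have "\<forall>i<card F. A i \<ge> 1"
    using nz hF by (auto simp: A_def Suc_le_eq) (metis prod.collapse)
  moreover have "card F \<ge> 1" using False fin by (simp add: Suc_le_eq card_gt_0_iff)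
  ultimately have "infinite {m. \<forall>i<card F. prime (A i * m + B i)}"
    using Dickson unfolding Dickson_conjecture_def by blast
  then obtain m where m: "\<forall>i<card F. prime (A i * m + B i)"
    using infinite_imp_nonempty by blast
  have "a * (int m + S) + b \<in> Pr" if "(a, b) \<in> F" for a b
  proof -
    have "(a, b) \<in> h ` {..<card F}" using h that by (simp add: bij_betw_def)
    then obtain i where i: "i < card F" "h i = (a, b)" by force
    have "prime (int (A i * m + B i))"
      by (rule prime_nat_int_transfer[THEN iffD2, OF m[rule_format, OF i(1)]])
    then have "prime (sgn a * (a * (int m + S) + b))"
      unfolding val[OF i(1)] i(2) by (simp only: fst_conv snd_conv)
    then show ?thesis by (auto simp: sgn_if Pr_def split: if_splits)
  qed
  moreover have "int m + S \<ge> L"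
  proof -
    have "(\<Sum>(a, b)\<in>F. \<bar>b\<bar>) \<ge> 0" by (rule sum_nonneg) auto
    then show ?thesis by (simp add: S_def)
  qed
  ultimately show ?thesis by blast
qed auto

text \<open>
  A form in \<open>G\<close> is disposed of in one of two ways. If it is proportional to some form in \<open>F\<close>, it
  is a proper multiple of it, because forms in \<open>F\<close> are primitive. Otherwise a residue class modulo a
  large new prime \<open>q\<close> makes it divisible by \<open>q\<close> without creating an obstruction for \<open>F\<close>.
\<close>

lemma Dickson_int_avoiding:
  fixes F G :: "(int \<times> int) set"
  assumes Dickson: Dickson_conjecture and "finite G" and "finite F"
    and "\<And>a b. (a, b) \<in> F \<union> G \<Longrightarrow> a \<noteq> 0"
    and "\<And>p. prime p \<Longrightarrow> \<exists>w. \<forall>(a, b) \<in> F. \<not> p dvd a * w + b"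
    and "\<And>a b. (a, b) \<in> G \<Longrightarrow> (a, b) \<notin> F \<and> (- a, - b) \<notin> F"
  shows "\<exists>w\<ge>L. (\<forall>(a, b) \<in> F. a * w + b \<in> Pr) \<and> (\<forall>(a, b) \<in> G. a * w + b \<notin> Pr)"
  using assms(2-)
proof (induction "card G" arbitrary: F G L)
  case 0
  then show ?case using Dickson_int[OF Dickson, of F L] by auto
next
  case (Suc n)
  obtain a' b' G' where G: "G = insert (a', b') G'" "(a', b') \<notin> G'"
    by (metis Suc.hyps(2) card_Suc_eq surj_pair)
  have G': "finite G'" "n = card G'" using Suc G by auto
  have a': "a' \<noteq> 0" using Suc.prems(3) G by auto
  show ?case
  proof (cases "\<exists>(a, b) \<in> F. a * b' = a' * b")
    case True
    then obtain a b where ab: "(a, b) \<in> F" "a * b' = a' * b" by auto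
    have "a \<noteq> 0" using ab Suc.prems by auto
    \<comment> \<open>A prime dividing both coefficients would divide every value and violate the
      local condition.\<close>
    have "coprime a b"
    proof (rule ccontr)
      assume "\<not> coprime a b"
      then obtain p where "prime p" "p dvd gcd a b"
        using \<open>a \<noteq> 0\<close> prime_divisor_exists[of "gcd a b"]
        by (metis coprime_iff_gcd_eq_1 gcd_eq_0_iff is_unit_gcd_iff)
      with Suc.prems(4)[of p] ab(1) show False by fastforce
    qed
    then have "a dvd a'" using ab(2) by (metis coprime_dvd_mult_left_iff dvd_triv_left)
    then obtain t where t: "a' = a * t" by auto
    then have t': "b' = b * t" using ab(2) \<open>a \<noteq> 0\<close> by simp
    have "t \<noteq> 1" "t \<noteq> -1" using Suc.prems(5)[of a' b'] G(1) ab(1) t t' by auto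
    then have "\<not> is_unit t" by auto
    obtain w where w: "w \<ge> L" "\<forall>(a, b) \<in> F. a * w + b \<in> Pr" "\<forall>(a, b) \<in> G'. a * w + b \<notin> Pr"
      using Suc.hyps(1)[OF G'(2) G'(1) Suc.prems(2), of L] Suc.prems(3-5) G(1) by auto
    have "a' * w + b' \<notin> Pr"
    proof
      assume "a' * w + b' \<in> Pr"
      then have "prime_elem (t * (a * w + b))"
        by (auto simp: t t' Pr_iff_prime_abs algebra_simps dest!: prime_imp_prime_elem)
      moreover have "\<not> is_unit (a * w + b)"
        using w(2) ab(1) not_prime_unit[of "\<bar>a * w + b\<bar>"] by (auto simp: Pr_iff_prime_abs)
      ultimately show False using \<open>\<not> is_unit t\<close>
        by (metis irreducible_def prime_elem_imp_irreducible)
    qed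
    with w G(1) show ?thesis by auto
  next
    case False
    \<comment> \<open>A prime \<open>q\<close> above \<open>\<bar>a'\<bar>\<close> makes
      \<open>a'\<close> invertible modulo \<open>q\<close>; being above the determinants as well, it
      divides no form of \<open>F\<close> at the root of \<open>a' * w + b'\<close>.\<close>
    define bnd where "bnd = \<bar>a'\<bar> + (\<Sum>(a, b)\<in>F. \<bar>a * b' - a' * b\<bar>)"
    obtain q0 where q0: "prime q0" "q0 > nat bnd" using bigger_prime by blast
    define q where "q = int q0"
    have q: "prime q" "q > bnd" using q0 by (auto simp: q_def)
    have bnd: "\<bar>a * b' - a' * b\<bar> \<le> bnd" if "(a, b) \<in> F" for a b
      using member_le_sum[OF that, of "\<lambda>(a, b). \<bar>a * b' - a' * b\<bar>"] Suc.prems(2)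
      by (auto simp: bnd_def)
    have "\<bar>a'\<bar> \<le> bnd" by (auto simp: bnd_def intro!: sum_nonneg)
    then have "\<not> q dvd a'" using q a' zdvd_imp_le[of q "\<bar>a'\<bar>"] by auto
    then obtain r0 where r0: "q dvd a' * r0 + b'" using linear_congruence_solvable q by blast
    define r where "r = r0 mod q"
    have r: "q dvd a' * r + b'"
    proof -
      have "q dvd a' * r0 + b' - a' * (r0 - r0 mod q)" using r0 by (meson dvd_diff dvd_minus_mod dvd_mult)
      then show ?thesis by (simp add: r_def algebra_simps)
    qed
    have r_nonneg: "r \<ge> 0" using q by (simp add: r_def prime_gt_0_int)
    \<comment> \<open>Effect on coefficients of restricting the unknown to the class of
      \<open>r\<close> modulo \<open>q\<close>; the induction hypothesis is applied to the
      restricted forms.\<close>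
    define \<theta> where "\<theta> = (\<lambda>(a, b). (a * q, a * r + b))"
    have inj: "inj \<theta>" using q by (auto simp: inj_def \<theta>_def)
    have "q \<noteq> 0" using q by auto
    have 1: "n = card (\<theta> ` G')" using G' inj by (metis card_image inj_on_subset subset_UNIV)
    have 2: "\<exists>w. \<forall>(a, b) \<in> \<theta> ` F. \<not> p dvd a * w + b" if p: "prime p" for p
    proof (cases "p = q")
      case True
      have "\<not> q dvd a * r + b" if "(a, b) \<in> F" for a b
      proof
        assume "q dvd a * r + b"
        then have "q dvd a * (a' * r + b') - a' * (a * r + b)" using r by (meson dvd_diff dvd_mult)
        then have "q dvd \<bar>a * b' - a' * b\<bar>" by (simp add: algebra_simps)
        moreover have "a * b' - a' * b \<noteq> 0" using False that by auto
        ultimately have "q \<le> \<bar>a * b' - a' * b\<bar>" by (intro zdvd_imp_le) auto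
        with bnd[OF that] q show False by auto
      qed
      then show ?thesis using True by (intro exI[of _ 0]) (auto simp: \<theta>_def)
    next
      case False
      then have "\<not> p dvd q" using p q primes_dvd_imp_eq by blast
      obtain w where w: "\<forall>(a, b) \<in> F. \<not> p dvd a * w + b" using Suc.prems(4) p by blast
      obtain w' where w': "p dvd q * w' + (r - w)"
        using linear_congruence_solvable[OF p \<open>\<not> p dvd q\<close>] by blast
      have "\<not> p dvd a * q * w' + (a * r + b)" if "(a, b) \<in> F" for a b
      proof
        assume "p dvd a * q * w' + (a * r + b)"
        then have "p dvd a * q * w' + (a * r + b) - a * (q * w' + (r - w))"
          using w' by (meson dvd_diff dvd_mult)
        then have "p dvd a * w + b" by (simp add: algebra_simps)
        with w that show False by auto
      qed
      then show ?thesis by (intro exI[of _ w']) (auto simp: \<theta>_def)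
    qed
    have neg: "(- fst (\<theta> z), - snd (\<theta> z)) = \<theta> (- fst z, - snd z)" for z
      by (auto simp: \<theta>_def split: prod.split)
    have 3: "(a, b) \<notin> \<theta> ` F \<and> (- a, - b) \<notin> \<theta> ` F" if "(a, b) \<in> \<theta> ` G'" for a b
    proof -
      obtain z where z: "z \<in> G'" "(a, b) = \<theta> z" using \<open>(a, b) \<in> \<theta> ` G'\<close> by auto
      then have "z \<notin> F" "(- fst z, - snd z) \<notin> F"
        using Suc.prems(5)[of "fst z" "snd z"] G(1) by auto
      moreover have "(- a, - b) = \<theta> (- fst z, - snd z)" using neg[of z] z(2) by (metis fst_conv snd_conv)
      ultimately show ?thesis using z(2) inj by (simp add: inj_image_mem_iff)
    qed
    have nz: "(0, b) \<notin> F \<union> G" for b using Suc.prems(3) by blast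
    have 4: "a \<noteq> 0" if "(a, b) \<in> \<theta> ` F \<union> \<theta> ` G'" for a b
      using that nz G(1) \<open>q \<noteq> 0\<close> by (auto simp: \<theta>_def)
    \<comment> \<open>Large enough that \<open>\<bar>a' * W + b'\<bar> > q\<close>, so that
      divisibility by \<open>q\<close> really excludes membership in \<open>Pr\<close>.\<close>
    define L' where "L' = \<bar>L\<bar> + \<bar>b'\<bar> + q + 1"
    have "\<exists>w\<ge>L'. (\<forall>(a, b) \<in> \<theta> ` F. a * w + b \<in> Pr) \<and> (\<forall>(a, b) \<in> \<theta> ` G'. a * w + b \<notin> Pr)"
    proof (rule Suc.hyps(1)[of "\<theta> ` G'" "\<theta> ` F" L'])
      show "n = card (\<theta> ` G')" by (fact 1)
      show "finite (\<theta> ` G')" "finite (\<theta> ` F)" using G'(1) Suc.prems(2) by auto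
    qed (fact 4 2 3)+
    then obtain w where w: "w \<ge> L'" "\<forall>(a, b) \<in> \<theta> ` F. a * w + b \<in> Pr"
        "\<forall>(a, b) \<in> \<theta> ` G'. a * w + b \<notin> Pr"
      by blast
    define W where "W = q * w + r"
    have "q > 1" using q by (simp add: prime_gt_1_int)
    have "w \<ge> 0" using w(1) \<open>q > 1\<close> by (simp add: L'_def)
    then have "W \<ge> w" using \<open>q > 1\<close> r_nonneg mult_right_mono[of 1 q w] by (simp add: W_def)
    have F: "a * W + b \<in> Pr" if "(a, b) \<in> F" for a b
      using w(2)[rule_format, OF imageI[OF that]] by (simp add: \<theta>_def W_def algebra_simps)
    have G'': "a * W + b \<notin> Pr" if "(a, b) \<in> G'" for a b
      using w(3)[rule_format, OF imageI[OF that]] by (simp add: \<theta>_def W_def algebra_simps)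
    have "a' * W + b' \<notin> Pr"
    proof
      assume P: "a' * W + b' \<in> Pr"
      have "q dvd (a' * r + b') + q * (a' * w)" using r by simp
      then have d: "q dvd a' * W + b'" by (simp add: W_def algebra_simps)
      have "W \<le> \<bar>a'\<bar> * W" using a' \<open>W \<ge> w\<close> \<open>w \<ge> 0\<close> mult_right_mono[of 1 "\<bar>a'\<bar>" W] by linarith
      also have "\<dots> = \<bar>a' * W\<bar>" using \<open>W \<ge> w\<close> \<open>w \<ge> 0\<close> by (simp add: abs_mult)
      finally have "q < \<bar>a' * W + b'\<bar>" using w(1) \<open>W \<ge> w\<close> unfolding L'_def by linarith
      with not_prime_dvd_Pr[OF P q(1)] d show False by blast
    qed
    moreover have "W \<ge> L" using \<open>W \<ge> w\<close> w(1) \<open>q > 1\<close> by (simp add: L'_def)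
    moreover have "\<forall>(a, b) \<in> F. a * W + b \<in> Pr" using F by blast
    moreover have "\<forall>(a, b) \<in> G'. a * W + b \<notin> Pr" using G'' by blast
    ultimately show ?thesis unfolding G(1) by blast
  qed
qed

section \<open>Realising patterns along a line\<close>

text \<open>A form whose slope is prime to \<open>p\<close> has at most one root modulo
  \<open>p\<close>, so fewer than \<open>p\<close> such forms leave a residue free.\<close>

lemma exists_non_root_mod_prime:
  fixes S :: "(int \<times> int) set"
  assumes p: "prime p" and fin: "finite S" and card: "int (card S) < p"
    and nd: "\<And>a b. (a, b) \<in> S \<Longrightarrow> \<not> p dvd a"
  shows "\<exists>w. \<forall>(a, b) \<in> S. \<not> p dvd a * w + b"
proof (rule ccontr)
  assume "\<not> ?thesis"
  then have *: "\<exists>z\<in>S. p dvd fst z * w + snd z" for w by fastforce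
  define R where "R z = {w \<in> {0..<p}. p dvd fst z * w + snd z}" for z
  have R: "card (R z) \<le> 1" if z: "z \<in> S" for z
  proof -
    have "w = w'" if "w \<in> R z" "w' \<in> R z" for w w'
    proof -
      have "p dvd (fst z * w + snd z) - (fst z * w' + snd z)"
        using that unfolding R_def by (intro dvd_diff) auto
      then have "p dvd fst z * (w - w')" by (simp add: algebra_simps)
      then have "p dvd w - w'"
        using nd[of "fst z" "snd z"] z p by (simp add: prime_dvd_mult_iff)
      then have "w mod p = w' mod p" by (simp add: mod_eq_dvd_iff)
      then show ?thesis using that by (simp add: R_def)
    qed
    then show ?thesis by (metis card_le_Suc0_iff_eq One_nat_def card.infinite zero_le_one)
  qed
  have "{0..<p} \<subseteq> (\<Union>z\<in>S. R z)" using * by (force simp: R_def)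
  then have "card {0..<p} \<le> card (\<Union>z\<in>S. R z)"
    using fin by (intro card_mono finite_UN_I) (auto simp: R_def intro: finite_subset[of _ "{0..<p}"])
  also have "\<dots> \<le> (\<Sum>z\<in>S. card (R z))" by (rule card_UN_le[OF fin])
  also have "\<dots> \<le> card S" using sum_mono[of S "\<lambda>z. card (R z)" "\<lambda>_. 1"] R by simp
  finally show False using card p by (simp add: prime_gt_0_int)
qed

text \<open>Records what atomic formulas see of a value: equality through small values,
  \<open>P_n\<close> through the residue, \<open>Pr\<close> (as \<open>u = 1\<close>) and
  \<open>Pr_n\<close> through the set. A value above \<open>N\<close> is only known to be large, and
  this is the freedom that Dickson's conjecture exploits.\<close>

definition pat :: "nat \<Rightarrow> nat \<Rightarrow> nat \<Rightarrow> int \<Rightarrow> int option \<times> int \<times> nat set" where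
  "pat K N D x =
    (if \<bar>x\<bar> \<le> int N then Some x else None, x mod int D,
     {u \<in> {1..K}. int u dvd x \<and> x div int u \<in> Pr})"

lemma pat_eq_iff:
  "pat K N D x = pat K N D y \<longleftrightarrow>
    (\<bar>x\<bar> \<le> int N \<or> \<bar>y\<bar> \<le> int N \<longrightarrow> x = y) \<and> int D dvd x - y \<and>
    (\<forall>u\<in>{1..K}. (int u dvd x \<and> x div int u \<in> Pr) = (int u dvd y \<and> y div int u \<in> Pr))"
proof -
  have 1: "(if \<bar>x\<bar> \<le> int N then Some x else None) = (if \<bar>y\<bar> \<le> int N then Some y else None) \<longleftrightarrow>
    (\<bar>x\<bar> \<le> int N \<or> \<bar>y\<bar> \<le> int N \<longrightarrow> x = y)"
    by auto
  have 2: "{u \<in> A. P u} = {u \<in> A. Q u} \<longleftrightarrow> (\<forall>u\<in>A. P u = Q u)" for A :: "nat set" and P Q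
    by blast
  show ?thesis unfolding pat_def prod.inject 1 2 by (simp only: mod_eq_dvd_iff)
qed

lemma pat_mono:
  assumes "pat K' N' D' x = pat K' N' D' y" "K \<le> K'" "N \<le> N'" "D dvd D'"
  shows "pat K N D x = pat K N D y"
proof -
  have "int D dvd x - y"
    using assms(1,4) unfolding pat_eq_iff by (meson dvd_trans int_dvd_int_iff)
  moreover have "\<bar>z\<bar> \<le> int N \<Longrightarrow> \<bar>z\<bar> \<le> int N'" for z using assms(3) by linarith
  moreover have "u \<in> {1..K} \<Longrightarrow> u \<in> {1..K'}" for u using assms(2) by simp
  ultimately show ?thesis using assms(1) unfolding pat_eq_iff by blast
qed

lemma finite_range_pat:
  assumes "D > 0"
  shows "finite (range (pat K N D))"
proof (rule finite_subset)
  have "pat K N D x \<in> insert None (Some ` {- int N..int N}) \<times> {0..<int D} \<times> Pow {1..K}" for x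
    using assms by (auto simp: pat_def abs_le_iff intro!: imageI)
  then show "range (pat K N D) \<subseteq> insert None (Some ` {- int N..int N}) \<times> {0..<int D} \<times> Pow {1..K}"
    by blast
qed auto

lemma int_dvd_fact: "u \<in> {1..K} \<Longrightarrow> int u dvd fact K"
  using dvd_fact[of u K] by (simp flip: int_dvd_int_iff)

text \<open>
  The forms \<open>D * \<gamma> t * w + \<beta> t\<close> in the unknown \<open>w\<close> are to have the patterns of prescribed values
  \<open>y t\<close>. Since \<open>D\<close> has exactly the primes up to \<open>M\<close> as divisors, divisibility by these primes does not
  depend on \<open>w\<close>; \<open>N \<ge> K * M\<close> makes every prime quotient of \<open>y t\<close> exceed \<open>M\<close>, so they obstruct nothing.
\<close>

lemma realize_patterns:
  fixes \<gamma> \<beta> y :: "'t \<Rightarrow> int" and K M N :: nat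
  defines "D \<equiv> fact K * fact M"
  assumes Dickson: Dickson_conjecture and fin: "finite T" and KN: "K * M \<le> N"
    and const: "\<And>t. t \<in> T \<Longrightarrow> \<gamma> t = 0 \<Longrightarrow> pat K N D (\<beta> t) = pat K N D (y t)"
    and large: "\<And>t. t \<in> T \<Longrightarrow> \<gamma> t \<noteq> 0 \<Longrightarrow> \<bar>y t\<bar> > int N"
    and cong: "\<And>t. t \<in> T \<Longrightarrow> \<gamma> t \<noteq> 0 \<Longrightarrow> int D dvd \<beta> t - y t"
    and loc: "\<And>p. prime p \<Longrightarrow> p > int M \<Longrightarrow>
      \<exists>w. \<forall>t\<in>T. \<gamma> t \<noteq> 0 \<longrightarrow> \<not> p dvd int D * \<gamma> t * w + \<beta> t"
    and consistent: "\<And>t t' u u' \<sigma>. t \<in> T \<Longrightarrow> t' \<in> T \<Longrightarrow> \<gamma> t \<noteq> 0 \<Longrightarrow> u \<in> {1..K} \<Longrightarrow> u' \<in> {1..K} \<Longrightarrow>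
      int u dvd y t \<Longrightarrow> y t div int u \<in> Pr \<Longrightarrow> int u' dvd y t' \<Longrightarrow> y t' div int u' \<notin> Pr \<Longrightarrow>
      \<sigma> \<in> {1, -1} \<Longrightarrow> int u' * \<gamma> t = \<sigma> * int u * \<gamma> t' \<Longrightarrow> int u' * \<beta> t \<noteq> \<sigma> * int u * \<beta> t'"
  shows "\<exists>w. \<forall>t\<in>T. pat K N D (int D * \<gamma> t * w + \<beta> t) = pat K N D (y t)"
proof -
  have D: "int D = fact K * fact M" by (simp add: D_def)
  have D0: "int D \<noteq> 0" by (simp add: D)
  have uD: "int u dvd int D" if "u \<in> {1..K}" for u
    unfolding D using int_dvd_fact[OF that] by (rule dvd_mult2)
  have puD: "p * int u dvd int D" if u: "u \<in> {1..K}" and p: "prime p" "p \<le> int M" for p u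
  proof -
    obtain q where q: "p = int q" "prime q" using prime_int_natD[OF p(1)] by auto
    have "p dvd fact M" using int_dvd_fact[of q M] p q prime_ge_1_nat[of q] by simp
    then show ?thesis unfolding D using int_dvd_fact[OF u] by (metis mult.commute mult_dvd_mono)
  qed
  have u\<beta>: "int u dvd \<beta> t \<longleftrightarrow> int u dvd y t" if "t \<in> T" "\<gamma> t \<noteq> 0" "u \<in> {1..K}" for t u
    using cong[OF that(1,2)] uD[OF that(3)] by (meson dvd_diff_commute dvd_trans dvd_diff_right_iff
      dvd_diff_left_iff)
  \<comment> \<open>As \<open>u\<close> divides \<open>D\<close>, it divides all values of the form
    in \<open>w\<close> or none, as it does for \<open>y t\<close>. In the first case a demand on
    the value divided by \<open>u\<close> is a demand on an integral form.\<close>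
  define quot where "quot = (\<lambda>(t, u). ((int D * \<gamma> t) div int u, \<beta> t div int u))"
  define I where "I = {(t, u). t \<in> T \<and> u \<in> {1..K} \<and> \<gamma> t \<noteq> 0 \<and> int u dvd y t}"
  define I1 where "I1 = {(t, u) \<in> I. y t div int u \<in> Pr}"
  define I0 where "I0 = {(t, u) \<in> I. y t div int u \<notin> Pr}"
  have "I \<subseteq> T \<times> {1..K}" by (auto simp: I_def)
  then have finI: "finite I" using fin by (meson finite_SigmaI finite_atLeastAtMost finite_subset)
  have fin01: "finite I0" "finite I1" using finI by (auto simp: I0_def I1_def intro: finite_subset)
  have quot: "int D * \<gamma> t = int u * fst (quot (t, u))" "\<beta> t = int u * snd (quot (t, u))" "u > 0"
    if "(t, u) \<in> I" for t u
    using that uD[of u] u\<beta>[of t u] by (auto simp: I_def quot_def)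
  \<comment> \<open>Beyond this bound every form with nonzero slope exceeds \<open>N\<close> in
    absolute value, as its model \<open>y t\<close> does.\<close>
  define L where "L = int N + 1 + (\<Sum>t\<in>T. \<bar>\<beta> t\<bar>)"
  have "\<exists>w\<ge>L. (\<forall>(a, b) \<in> quot ` I1. a * w + b \<in> Pr) \<and> (\<forall>(a, b) \<in> quot ` I0. a * w + b \<notin> Pr)"
  proof (rule Dickson_int_avoiding[OF Dickson])
    show "finite (quot ` I0)" "finite (quot ` I1)" using fin01 by auto
    show "a \<noteq> 0" if "(a, b) \<in> quot ` I1 \<union> quot ` I0" for a b
    proof -
      from that obtain t u where tu: "(t, u) \<in> I" "quot (t, u) = (a, b)"
        by (auto simp: I0_def I1_def)
      then show ?thesis using quot(1)[OF tu(1)] D0 by (auto simp: I_def)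
    qed
    show "\<exists>w. \<forall>(a, b) \<in> quot ` I1. \<not> p dvd a * w + b" if p: "prime p" for p
    proof (cases "p \<le> int M")
      case True
      \<comment> \<open>At \<open>w = 0\<close>: because \<open>p * u\<close> divides
        \<open>D\<close>, the quotient of \<open>\<beta> t\<close> is congruent modulo
        \<open>p\<close> to that of \<open>y t\<close>, which is a prime up to sign and exceeds
        \<open>M\<close>.\<close>
      have "\<not> p dvd b" if "(a, b) \<in> quot ` I1" for a b
      proof
        assume pb: "p dvd b"
        from that obtain t u where tu: "(t, u) \<in> I" "quot (t, u) = (a, b)" "y t div int u \<in> Pr"
          by (auto simp: I1_def)
        have t: "t \<in> T" "\<gamma> t \<noteq> 0" "u \<in> {1..K}" "int u dvd y t" using tu(1) by (auto simp: I_def)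
        then obtain z where z: "y t = int u * z" by auto
        then have zPr: "z \<in> Pr" using tu(3) t(3) by simp
        have "\<beta> t = int u * b" using quot(2)[OF tu(1)] tu(2) by simp
        moreover have "p * int u dvd \<beta> t - y t"
          using puD[OF t(3) p True] cong[OF t(1,2)] by (rule dvd_trans)
        ultimately have "int u * p dvd int u * (b - z)" by (simp add: z algebra_simps)
        then have "p dvd b - z" using t(3) by simp
        then have pz: "p dvd z" using pb by (metis dvd_diff_right_iff)
        have "int K * int M < int u * \<bar>z\<bar>"
          using large[OF t(1,2)] KN by (simp add: z abs_mult) (metis of_nat_mult of_nat_mono order_le_less_trans)
        also have "\<dots> \<le> int K * \<bar>z\<bar>" using t(3) by (intro mult_right_mono) auto
        finally have "int M < \<bar>z\<bar>" using mult_less_cancel_left_pos[of "int K" "int M" "\<bar>z\<bar>"] t(3) by auto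
        then show False using not_prime_dvd_Pr[OF zPr p] True pz by auto
      qed
      then have "\<not> p dvd fst z * 0 + snd z" if "z \<in> quot ` I1" for z
        using that by (simp add: prod.collapse) (metis prod.collapse)
      then show ?thesis by (metis (no_types, lifting) case_prod_unfold)
    next
      case False
      then obtain w where w: "\<forall>t\<in>T. \<gamma> t \<noteq> 0 \<longrightarrow> \<not> p dvd int D * \<gamma> t * w + \<beta> t"
        using loc[OF p] by auto
      have "\<not> p dvd a * w + b" if "(a, b) \<in> quot ` I1" for a b
      proof
        assume pb: "p dvd a * w + b"
        from that obtain t u where tu: "(t, u) \<in> I" "quot (t, u) = (a, b)"
          by (auto simp: I1_def)
        have "int D * \<gamma> t * w + \<beta> t = int u * (a * w + b)"
          using quot(1,2)[OF tu(1)] tu(2) by (simp add: algebra_simps)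
        then have "p dvd int D * \<gamma> t * w + \<beta> t" using pb by simp
        with w tu(1) show False by (auto simp: I_def)
      qed
      then show ?thesis by blast
    qed
    \<comment> \<open>A form and its negative make the same demand. Both coincidences are excluded
      by \<open>consistent\<close> once the denominators \<open>u\<close> and \<open>u'\<close> are
      cleared.\<close>
    have noconf: False if tu: "(t, u) \<in> I1" and tu': "(t', u') \<in> I0" and \<sigma>: "\<sigma> \<in> {1, -1}"
      and e1: "fst (quot (t, u)) = \<sigma> * fst (quot (t', u'))"
      and e2: "snd (quot (t, u)) = \<sigma> * snd (quot (t', u'))" for t u t' u' \<sigma>
    proof -
      have I: "(t, u) \<in> I" "(t', u') \<in> I" using tu tu' by (auto simp: I0_def I1_def)
      have "int u' * (int D * \<gamma> t) = \<sigma> * int u * (int D * \<gamma> t')"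
        unfolding quot(1)[OF I(1)] quot(1)[OF I(2)] e1 by simp
      then have "int D * (int u' * \<gamma> t) = int D * (\<sigma> * int u * \<gamma> t')" by (simp only: ac_simps)
      then have 1: "int u' * \<gamma> t = \<sigma> * int u * \<gamma> t'" using D0 by simp
      have 2: "int u' * \<beta> t = \<sigma> * int u * \<beta> t'"
        unfolding quot(2)[OF I(1)] quot(2)[OF I(2)] e2 by simp
      show False
        using consistent[of t t' u u' \<sigma>] tu tu' \<sigma> 1 2 by (auto simp: I_def I0_def I1_def)
    qed
    show "(a, b) \<notin> quot ` I1 \<and> (- a, - b) \<notin> quot ` I1" if "(a, b) \<in> quot ` I0" for a b
    proof -
      from that obtain z' where z': "z' \<in> I0" "(a, b) = quot z'" by (rule imageE)
      have I0: "(fst z', snd z') \<in> I0" using z'(1) by simp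
      have neq: "quot z \<noteq> (\<sigma> * a, \<sigma> * b)" if "z \<in> I1" "\<sigma> \<in> {1, -1}" for z \<sigma>
      proof
        assume z: "quot z = (\<sigma> * a, \<sigma> * b)"
        have ab: "a = fst (quot z')" "b = snd (quot z')" unfolding z'(2)[symmetric] by simp_all
        have I1: "(fst z, snd z) \<in> I1" using that(1) by simp
        show False
          by (rule noconf[OF I1 I0 that(2)]) (simp_all add: z ab)
      qed
      have "(\<sigma> * a, \<sigma> * b) \<notin> quot ` I1" if "\<sigma> \<in> {1, -1}" for \<sigma>
        using neq[OF _ that] by (metis imageE)
      from this[of 1] this[of "-1"] show ?thesis by simp
    qed
  qed
  then obtain w where w: "w \<ge> L" "\<forall>(a, b) \<in> quot ` I1. a * w + b \<in> Pr"
      "\<forall>(a, b) \<in> quot ` I0. a * w + b \<notin> Pr"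
    by blast
  have "pat K N D (int D * \<gamma> t * w + \<beta> t) = pat K N D (y t)" if t: "t \<in> T" for t
  proof (cases "\<gamma> t = 0")
    case True
    then show ?thesis using const t by simp
  next
    case False
    define X where "X = int D * \<gamma> t * w + \<beta> t"
    have "\<bar>\<beta> t\<bar> \<le> (\<Sum>t\<in>T. \<bar>\<beta> t\<bar>)" using member_le_sum[OF t, of "\<lambda>t. \<bar>\<beta> t\<bar>"] fin by auto
    then have wb: "w > \<bar>\<beta> t\<bar> + int N" using w(1) by (simp add: L_def)
    have "int D * \<gamma> t \<noteq> 0" using D0 False by simp
    then have "\<bar>int D * \<gamma> t\<bar> \<ge> 1" by linarith
    then have "w \<le> \<bar>int D * \<gamma> t\<bar> * \<bar>w\<bar>" using mult_right_mono[of 1 "\<bar>int D * \<gamma> t\<bar>" "\<bar>w\<bar>"] by linarith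
    then have X: "\<bar>X\<bar> > int N" using wb unfolding X_def abs_mult[symmetric] by linarith
    have "(int u dvd X \<and> X div int u \<in> Pr) = (int u dvd y t \<and> y t div int u \<in> Pr)"
      if u: "u \<in> {1..K}" for u
    proof -
      have "int u dvd int D * \<gamma> t * w" using uD[OF u] by (simp add: mult.assoc)
      then have d: "int u dvd X \<longleftrightarrow> int u dvd y t"
        unfolding X_def using u\<beta>[OF t False u] by (simp add: dvd_add_right_iff)
      have "X div int u \<in> Pr \<longleftrightarrow> y t div int u \<in> Pr" if "int u dvd y t"
      proof -
        have I: "(t, u) \<in> I" using that t u False by (auto simp: I_def)
        have "X = int u * (fst (quot (t, u)) * w + snd (quot (t, u)))"
          unfolding X_def quot(1)[OF I] by (subst quot(2)[OF I]) (simp add: algebra_simps)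
        then have "X div int u = fst (quot (t, u)) * w + snd (quot (t, u))" using u by simp
        moreover have "quot (t, u) \<in> quot ` I1 \<longleftrightarrow> True" if "y t div int u \<in> Pr"
          using I that by (auto simp: I1_def)
        moreover have "quot (t, u) \<in> quot ` I0 \<longleftrightarrow> True" if "y t div int u \<notin> Pr"
          using I that by (auto simp: I0_def)
        ultimately show ?thesis using w(2,3) by (metis (no_types, lifting) case_prod_unfold)
      qed
      with d show ?thesis by blast
    qed
    moreover have "int D dvd X - y t"
    proof -
      have "int D dvd int D * (\<gamma> t * w) + (\<beta> t - y t)" using cong[OF t False] by simp
      then show ?thesis by (simp add: X_def algebra_simps)
    qed
    ultimately show ?thesis
      using X large[OF t False] unfolding pat_eq_iff X_def[symmetric] by auto
  qed
  then show ?thesis by blast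
qed

section \<open>Quantifier elimination\<close>

lemma pat_eq_dvd: "pat K N D x = pat K N D y \<Longrightarrow> int D dvd x - y"
  unfolding pat_eq_iff by blast

lemma pat_eq_small: "pat K N D x = pat K N D y \<Longrightarrow> \<bar>x\<bar> \<le> int N \<Longrightarrow> y = x"
  unfolding pat_eq_iff by blast

lemma pat_eq_zero: "pat K N D x = pat K N D y \<Longrightarrow> x = 0 \<Longrightarrow> y = 0"
  using pat_eq_small[of K N D x y] by simp

lemma pat_eq_Pr:
  "pat K N D x = pat K N D y \<Longrightarrow> u \<in> {1..K} \<Longrightarrow>
    (int u dvd x \<and> x div int u \<in> Pr) = (int u dvd y \<and> y div int u \<in> Pr)"
  unfolding pat_eq_iff by blast

text \<open>Dividing by \<open>c\<close> costs a bounded factor in each component: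
  \<open>Y / u\<close> is, up to sign, \<open>c * Y / (\<bar>c\<bar> * u)\<close>, and the residue
  survives because \<open>c\<close> divides \<open>fact M\<close>. This allows a variable with
  coefficient \<open>c\<close> to be eliminated by multiplying through with
  \<open>c\<close>.\<close>

lemma pat_cancel:
  fixes c Y Y' :: int
  assumes c: "c \<noteq> 0" "\<bar>c\<bar> \<le> int M"
    and eq: "pat (K * M) (N * M) (D * fact M) (c * Y) = pat (K * M) (N * M) (D * fact M) (c * Y')"
  shows "pat K N D Y = pat K N D Y'"
proof -
  note eq' = eq[unfolded pat_eq_iff]
  have small: "\<bar>c * Z\<bar> \<le> int (N * M)" if "\<bar>Z\<bar> \<le> int N" for Z
    using mult_mono[OF c(2) that] by (simp add: abs_mult mult.commute)
  have "Y = Y'" if "\<bar>Y\<bar> \<le> int N \<or> \<bar>Y'\<bar> \<le> int N"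
  proof -
    have "c * Y = c * Y'" using eq' small[of Y] small[of Y'] that by blast
    then show ?thesis using c(1) by simp
  qed
  moreover have "int D dvd Y - Y'"
  proof -
    have "nat \<bar>c\<bar> dvd fact M" using c by (intro dvd_fact) auto
    then have "c dvd int (fact M)" using nat_abs_dvd_iff[of c "fact M"] by simp
    then obtain e where e: "int (fact M) = c * e" by auto
    have "int (D * fact M) dvd c * Y - c * Y'" using eq' by blast
    then have "c * (int D * e) dvd c * (Y - Y')"
      unfolding of_nat_mult e by (simp only: algebra_simps)
    then have "int D * e dvd Y - Y'" using c(1) by simp
    then show ?thesis by (rule dvd_mult_left)
  qed
  moreover have "(int u dvd Y \<and> Y div int u \<in> Pr) = (int u dvd Y' \<and> Y' div int u \<in> Pr)"
    if u: "u \<in> {1..K}" for u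
  proof -
    define k where "k = nat \<bar>c\<bar> * u"
    have "nat \<bar>c\<bar> \<le> M" "u \<le> K" using c u by auto
    then have "k \<le> M * K" unfolding k_def by (rule mult_le_mono)
    then have k: "k \<in> {1..K * M}" using c u by (auto simp: k_def mult.commute Suc_le_eq)
    have k': "int k = sgn c * (c * int u)" by (simp add: k_def sgn_if abs_if)
    have "(int k dvd c * Z \<and> c * Z div int k \<in> Pr) = (int u dvd Z \<and> Z div int u \<in> Pr)" for Z
    proof -
      have d: "int k dvd c * Z \<longleftrightarrow> int u dvd Z" using c(1) by (simp add: k_def abs_if)
      moreover have "c * Z div int k \<in> Pr \<longleftrightarrow> Z div int u \<in> Pr" if uZ: "int u dvd Z"
      proof -
        obtain b where b: "Z = int u * b" using uZ unfolding dvd_def by blast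
        have "c * Z = int k * (sgn c * b)"
          using c(1) by (simp add: k' b sgn_if)
        then have "c * Z div int k = sgn c * b" using k by simp
        then show ?thesis using u c(1) by (simp add: b sgn_if)
      qed
      ultimately show ?thesis by blast
    qed
    then show ?thesis using eq' k by blast
  qed
  ultimately show ?thesis unfolding pat_eq_iff by blast
qed

lemma prime_not_dvd_fact_mult:
  fixes c p :: int
  assumes "prime p" "p > int M" "K \<le> M" "c \<noteq> 0" "\<bar>c\<bar> \<le> int M"
  shows "\<not> p dvd int (fact K * fact M) * c"
proof -
  obtain q where q: "prime q" "p = int q" using prime_int_natD assms(1) by blast
  have "\<not> q dvd fact K" "\<not> q dvd fact M" using q assms by (auto simp: prime_dvd_fact_iff)
  moreover have "\<not> p dvd c" using assms zdvd_imp_le[of p "\<bar>c\<bar>"] by auto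
  ultimately show ?thesis
    using q assms(1) by (auto simp: prime_dvd_mult_iff simp flip: int_dvd_int_iff)
qed

text \<open>The excluded equation says that \<open>y / u\<close> and \<open>y' / u'\<close> agree up
  to sign, and \<open>Pr\<close> is closed under negation.\<close>

lemma Pr_quotient_contradiction:
  fixes y y' :: int
  assumes "u \<in> {1..K}" "u' \<in> {1..K}" "int u dvd y" "y div int u \<in> Pr"
    "\<not> (int u' dvd y' \<and> y' div int u' \<in> Pr)" "\<sigma> \<in> {1, -1}"
  shows "int u' * y \<noteq> \<sigma> * int u * y'"
proof
  assume eq: "int u' * y = \<sigma> * int u * y'"
  obtain a where a: "y = int u * a" using assms(3) unfolding dvd_def by blast
  have "int u * (int u' * a) = int u * (\<sigma> * y')" using eq by (simp add: a ac_simps)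
  then have "\<sigma> * y' = int u' * a" using assms(1) by simp
  then have "y' = int u' * (\<sigma> * a)" using assms(6) by auto
  moreover have "a \<in> Pr" using assms(1,4) by (simp add: a)
  ultimately show False using assms(2,5,6) by auto
qed

section \<open>Affine forms and relations determined by patterns of their values\<close>

type_synonym form = "(nat \<Rightarrow> int) \<times> int"

definition ev :: "nat \<Rightarrow> form \<Rightarrow> (nat \<Rightarrow> int) \<Rightarrow> int" where
  "ev m f v = (\<Sum>j<m. fst f j * v j) + snd f"

definition comb :: "int \<Rightarrow> form \<Rightarrow> int \<Rightarrow> form \<Rightarrow> form" where
  "comb a f b g = (\<lambda>j. a * fst f j + b * fst g j, a * snd f + b * snd g)"

definition const_form :: "int \<Rightarrow> form" where
  "const_form a = (\<lambda>_. 0, a)"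

definition drop_var :: "nat \<Rightarrow> form \<Rightarrow> form" where
  "drop_var i f = ((fst f)(i := 0), snd f)"

lemma ev_comb [simp]: "ev m (comb a f b g) v = a * ev m f v + b * ev m g v"
  by (simp add: ev_def comb_def algebra_simps sum.distrib sum_distrib_left)

lemma ev_const_form [simp]: "ev m (const_form a) v = a"
  by (simp add: ev_def const_form_def)

lemma ev_update:
  assumes "i < m"
  shows "ev m f (v(i := z)) = fst f i * z + ev m (drop_var i f) v"
proof -
  have "(\<Sum>j<m. fst f j * (v(i := z)) j) = fst f i * z + (\<Sum>j\<in>{..<m} - {i}. fst f j * v j)"
    using assms by (subst sum.remove[of _ i]) auto
  moreover have "(\<Sum>j<m. ((fst f)(i := 0)) j * v j) = (\<Sum>j\<in>{..<m} - {i}. fst f j * v j)"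
    using assms by (subst sum.remove[of _ i]) auto
  ultimately show ?thesis by (simp add: ev_def drop_var_def)
qed

text \<open>
  Semantic substitute for quantifier-free definability: closure under projection replaces a
  syntactic quantifier elimination.
\<close>

definition tame :: "nat \<Rightarrow> ((nat \<Rightarrow> int) \<Rightarrow> bool) \<Rightarrow> bool" where
  "tame m R \<longleftrightarrow> (\<exists>F K N D. finite F \<and> D > 0 \<and>
    (\<forall>v v'. (\<forall>f\<in>F. pat K N D (ev m f v) = pat K N D (ev m f v')) \<longrightarrow> R v \<longrightarrow> R v'))"

lemma tameI:
  assumes "finite F" "D > 0"
    and "\<And>v v'. (\<And>f. f \<in> F \<Longrightarrow> pat K N D (ev m f v) = pat K N D (ev m f v')) \<Longrightarrow> R v \<Longrightarrow> R v'"
  shows "tame m R"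
  unfolding tame_def by (rule exI[of _ F], rule exI[of _ K], rule exI[of _ N], rule exI[of _ D]) (use assms in blast)

lemma tame_atom:
  assumes "\<And>x y. pat K N D x = pat K N D y \<Longrightarrow> P x \<Longrightarrow> P y" "D > 0"
  shows "tame m (\<lambda>v. P (ev m f v))"
proof (rule tameI[of "{f}" D K N])
  show "P (ev m f v')" if "\<And>g. g \<in> {f} \<Longrightarrow> pat K N D (ev m g v) = pat K N D (ev m g v')" "P (ev m f v)" for v v'
    by (rule assms(1)[OF that(1) that(2)]) simp
qed (use assms(2) in simp_all)

lemma tame_Not:
  assumes "tame m R"
  shows "tame m (\<lambda>v. \<not> R v)"
proof -
  obtain F K N D where "finite F" "D > 0"
    and *: "\<And>v v'. (\<forall>f\<in>F. pat K N D (ev m f v) = pat K N D (ev m f v')) \<Longrightarrow> R v \<Longrightarrow> R v'"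
    using assms unfolding tame_def by blast
  then show ?thesis
    unfolding tame_def by (intro exI[of _ F] exI[of _ K] exI[of _ N] exI[of _ D]) metis
qed

lemma tame_conj:
  assumes "tame m R" "tame m R'"
  shows "tame m (\<lambda>v. R v \<and> R' v)"
proof -
  obtain F K N D where 1: "finite F" "D > 0"
    and R: "\<And>v v'. (\<forall>f\<in>F. pat K N D (ev m f v) = pat K N D (ev m f v')) \<Longrightarrow> R v \<Longrightarrow> R v'"
    using assms(1) unfolding tame_def by blast
  obtain F' K' N' D' where 2: "finite F'" "D' > 0"
    and R': "\<And>v v'. (\<forall>f\<in>F'. pat K' N' D' (ev m f v) = pat K' N' D' (ev m f v')) \<Longrightarrow> R' v \<Longrightarrow> R' v'"
    using assms(2) unfolding tame_def by blast
  define K2 N2 D2 where "K2 = max K K'" "N2 = max N N'" "D2 = D * D'"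
  have "R v' \<and> R' v'"
    if *: "\<forall>f\<in>F \<union> F'. pat K2 N2 D2 (ev m f v) = pat K2 N2 D2 (ev m f v')" and "R v \<and> R' v" for v v'
  proof -
    have "pat K N D (ev m f v) = pat K N D (ev m f v')" if "f \<in> F" for f
      by (rule pat_mono[OF bspec[OF *]]) (use that in \<open>auto simp: K2_N2_D2_def\<close>)
    moreover have "pat K' N' D' (ev m f v) = pat K' N' D' (ev m f v')" if "f \<in> F'" for f
      by (rule pat_mono[OF bspec[OF *]]) (use that in \<open>auto simp: K2_N2_D2_def\<close>)
    ultimately show ?thesis using R[of v v'] R'[of v v'] \<open>R v \<and> R' v\<close> by blast
  qed
  moreover have "finite (F \<union> F')" "D2 > 0" using 1 2 by (auto simp: K2_N2_D2_def)
  ultimately show ?thesis by (intro tameI[of "F \<union> F'" D2 K2 N2]) blast+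
qed

text \<open>For assignments with equal patterns on enough forms without the variable, a witness
  \<open>z\<close> for one is turned into a witness \<open>z'\<close> for the other. Either a small
  value pins \<open>z'\<close> down, or \<open>z'\<close> is sought in the class of \<open>z\<close>
  modulo \<open>D1\<close>, where Dickson's conjecture applies.\<close>

lemma tame_Ex:
  assumes Dickson: Dickson_conjecture and R: "tame m R" and i: "i < m"
  shows "tame m (\<lambda>v. \<exists>z. R (v(i := z)))"
proof -
  obtain F K N D where fin: "finite F" and D: "D > 0"
    and R: "\<And>v v'. (\<forall>f\<in>F. pat K N D (ev m f v) = pat K N D (ev m f v')) \<Longrightarrow> R v \<Longrightarrow> R v'"
    using R unfolding tame_def by blast
  define c where "c f = fst f i" for f :: form
  define T where "T f = ev m (drop_var i f)" for f
  have upd: "ev m f (v(i := z)) = c f * z + T f v" for f v z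
    using ev_update[OF i] by (simp add: c_def T_def)
  \<comment> \<open>The summand \<open>D\<close> makes \<open>D\<close> divide
    \<open>fact M\<close>. For a prime above \<open>M\<close>, \<open>card F\<close> leaves more
    residues than roots, the slopes are invertible, and \<open>K\<close> keeps it from dividing
    \<open>fact K\<close>.\<close>
  define M where "M = K + D + card F + (\<Sum>f\<in>F. nat \<bar>c f\<bar>)"
  have cM: "\<bar>c f\<bar> \<le> int M" if "f \<in> F" for f
  proof -
    have "nat \<bar>c f\<bar> \<le> (\<Sum>f\<in>F. nat \<bar>c f\<bar>)"
      using member_le_sum[OF that, of "\<lambda>f. nat \<bar>c f\<bar>"] fin by simp
    then have "nat \<bar>c f\<bar> \<le> M" unfolding M_def by linarith
    then show ?thesis by linarith
  qed
  have M: "K \<le> M" "D \<le> M" "card F \<le> M" "1 \<le> M" using D by (auto simp: M_def)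
  define N2 where "N2 = N + K * M"
  define D1 :: nat where "D1 = fact K * fact M"
  have "D dvd fact M" using D M by (intro dvd_fact) auto
  then have DD1: "D dvd D1" by (simp add: D1_def)
  \<comment> \<open>Enlarged by the factors that \<open>pat_cancel\<close> loses when a coefficient
    of size at most \<open>M\<close> is divided out.\<close>
  define K' N' D' where "K' = K * M" "N' = N2 * M" "D' = D1 * fact M"
  have pars: "K \<le> K'" "N2 \<le> N'" "D1 dvd D'"
    using M by (auto simp: K'_N'_D'_def)
  define F1 where "F1 = drop_var i ` F"
  \<comment> \<open>If the slopes of \<open>f / u\<close> and \<open>f' / u'\<close> agree up to
    \<open>\<sigma>\<close>, vanishing of this combination means that the two quotients are the same
    form in the variable, up to sign.\<close>
  define F2 where "F2 = (\<lambda>(f, f', u, u', \<sigma>). comb (int u') (drop_var i f) (- \<sigma> * int u) (drop_var i f')) `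
    (F \<times> F \<times> {1..K} \<times> {1..K} \<times> {1, -1})"
  \<comment> \<open>If \<open>f\<close> takes the value \<open>j\<close> at \<open>z\<close>, this
    combination is \<open>c f\<close> times the value of \<open>f'\<close> at \<open>z\<close>,
    expressed without \<open>z\<close>.\<close>
  define F3 where "F3 = (\<lambda>(f, f', j). comb 1 (comb (c f) (drop_var i f') (- c f') (drop_var i f)) (c f') (const_form j)) `
    (F \<times> F \<times> {- int N2..int N2})"
  have "\<exists>z'. R (v'(i := z'))"
    if F': "\<forall>f\<in>F1 \<union> F2 \<union> F3. pat K' N' D' (ev m f v) = pat K' N' D' (ev m f v')"
      and ex: "\<exists>z. R (v(i := z))" for v v'
  proof -
    obtain z where z: "R (v(i := z))" using ex by blast
    have T: "pat K N2 D1 (T f v) = pat K N2 D1 (T f v')" if "f \<in> F" for f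
      unfolding T_def by (rule pat_mono[OF bspec[OF F'] pars]) (use that in \<open>auto simp: F1_def\<close>)
    have "\<exists>z'. \<forall>f\<in>F. pat K N2 D1 (c f * z' + T f v') = pat K N2 D1 (c f * z + T f v)"
    \<comment> \<open>If a form containing the variable takes a small value, this value determines \<open>z'\<close>.\<close>
    proof (cases "\<exists>f\<in>F. c f \<noteq> 0 \<and> \<bar>c f * z + T f v\<bar> \<le> int N2")
      case True
      then obtain f0 where f0: "f0 \<in> F" "c f0 \<noteq> 0" "\<bar>c f0 * z + T f0 v\<bar> \<le> int N2" by blast
      define j where "j = c f0 * z + T f0 v"
      have j: "j \<in> {- int N2..int N2}" using f0(3) by (auto simp: j_def)
      \<comment> \<open>Solvability of \<open>c f0 * z' + T f0 v' = j\<close>: the coefficient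
        divides \<open>D1\<close>, modulo which \<open>T f0\<close> agrees at \<open>v\<close> and
        \<open>v'\<close>.\<close>
      have "nat \<bar>c f0\<bar> dvd fact M" using cM[OF f0(1)] f0(2) by (intro dvd_fact) auto
      then have "nat \<bar>c f0\<bar> dvd D1" by (simp add: D1_def)
      then have "c f0 dvd int D1" by (simp only: nat_abs_dvd_iff)
      moreover have "int D1 dvd T f0 v - T f0 v'" by (rule pat_eq_dvd[OF T[OF f0(1)]])
      ultimately have "c f0 dvd c f0 * z + (T f0 v - T f0 v')" using dvd_trans by (intro dvd_add) auto
      then have "c f0 dvd j - T f0 v'" by (simp add: j_def add_diff_eq)
      then obtain z' where z': "j - T f0 v' = c f0 * z'" unfolding dvd_def by blast
      have "pat K N2 D1 (c f * z' + T f v') = pat K N2 D1 (c f * z + T f v)" if f: "f \<in> F" for f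
      proof -
        define g where "g = comb 1 (comb (c f0) (drop_var i f) (- c f) (drop_var i f0)) (c f) (const_form j)"
        have g: "g \<in> F3" unfolding F3_def g_def using f f0(1) j by (force intro: rev_image_eqI)
        have "ev m g v = c f0 * T f v + c f * (j - T f0 v)"
          "ev m g v' = c f0 * T f v' + c f * (j - T f0 v')"
          by (simp_all add: g_def T_def algebra_simps)
        then have "ev m g v = c f0 * (c f * z + T f v)" "ev m g v' = c f0 * (c f * z' + T f v')"
          unfolding z' by (simp_all add: j_def algebra_simps)
        moreover have "pat K' N' D' (ev m g v) = pat K' N' D' (ev m g v')" using F' g by blast
        ultimately show ?thesis
          using pat_cancel[OF f0(2) cM[OF f0(1)]] unfolding K'_N'_D'_def by metis
      qed
      then show ?thesis by blast
    next
      case False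
      \<comment> \<open>All forms containing the variable have large values, so the ansatz
        \<open>z' = z + D1 * w\<close> leaves only the demands concerning primes.\<close>
      have "\<exists>w. \<forall>f\<in>F. pat K N2 (fact K * fact M) (int (fact K * fact M) * c f * w + (c f * z + T f v'))
          = pat K N2 (fact K * fact M) (c f * z + T f v)"
      proof (rule realize_patterns[OF Dickson fin], unfold D1_def[symmetric])
        show "K * M \<le> N2" by (simp add: N2_def)
        show "pat K N2 D1 (c f * z + T f v') = pat K N2 D1 (c f * z + T f v)" if "f \<in> F" "c f = 0" for f
          using T that by simp
        show "int N2 < \<bar>c f * z + T f v\<bar>" if "f \<in> F" "c f \<noteq> 0" for f
          using False that by auto
        show "int D1 dvd c f * z + T f v' - (c f * z + T f v)" if "f \<in> F" for f
          using pat_eq_dvd[OF T[OF that, symmetric]] by simp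
        show "\<exists>w. \<forall>f\<in>F. c f \<noteq> 0 \<longrightarrow> \<not> p dvd int D1 * c f * w + (c f * z + T f v')"
          if p: "prime p" "p > int M" for p
        proof -
          define S where "S = (\<lambda>f. (int D1 * c f, c f * z + T f v')) ` {f \<in> F. c f \<noteq> 0}"
          have "card S \<le> card {f \<in> F. c f \<noteq> 0}" unfolding S_def using fin by (intro card_image_le) auto
          also have "\<dots> \<le> card F" using fin by (intro card_mono) auto
          finally have S: "int (card S) < p" using p(2) M(3) by linarith
          have nd: "\<not> p dvd a" if "(a, b) \<in> S" for a b
            using that prime_not_dvd_fact_mult[OF p M(1) _ cM] unfolding S_def D1_def by blast
          have "finite S" using fin by (simp add: S_def)
          then have "\<exists>w. \<forall>(a, b) \<in> S. \<not> p dvd a * w + b"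
            by (rule exists_non_root_mod_prime[OF p(1) _ S]) (rule nd)
          then obtain w where w: "\<forall>(a, b) \<in> S. \<not> p dvd a * w + b" by blast
          have "\<not> p dvd int D1 * c f * w + (c f * z + T f v')" if "f \<in> F" "c f \<noteq> 0" for f
          proof -
            have "(int D1 * c f, c f * z + T f v') \<in> S" using that unfolding S_def by blast
            with w show ?thesis by blast
          qed
          then show ?thesis by blast
        qed
        show "int u' * (c f * z + T f v') \<noteq> \<sigma> * int u * (c f' * z + T f' v')"
          if "f \<in> F" "f' \<in> F" and uu: "u \<in> {1..K}" "u' \<in> {1..K}" "int u dvd c f * z + T f v"
            "(c f * z + T f v) div int u \<in> Pr" "int u' dvd c f' * z + T f' v"
            "(c f' * z + T f' v) div int u' \<notin> Pr" "\<sigma> \<in> {1, - 1}"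
            and eq: "int u' * c f = \<sigma> * int u * c f'" for f f' u u' \<sigma>
        proof
          \<comment> \<open>The terms in \<open>z\<close> cancel by \<open>eq\<close>. The remaining
            relation between the parts without \<open>z\<close> is carried from \<open>v'\<close>
            back to \<open>v\<close> by \<open>F2\<close>, where the values at \<open>z\<close>
            contradict it.\<close>
          assume eq': "int u' * (c f * z + T f v') = \<sigma> * int u * (c f' * z + T f' v')"
          define g where "g = comb (int u') (drop_var i f) (- \<sigma> * int u) (drop_var i f')"
          have "g \<in> F2" unfolding F2_def g_def
            by (rule image_eqI[of _ _ "(f, f', u, u', \<sigma>)"]) (use that in simp_all)
          then have "pat K' N' D' (ev m g v) = pat K' N' D' (ev m g v')" using F' by blast
          then have "ev m g v' = 0 \<Longrightarrow> ev m g v = 0" by (rule pat_eq_zero[OF sym])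
          moreover have "ev m g v = int u' * T f v - \<sigma> * int u * T f' v" for v
            by (simp add: g_def T_def)
          ultimately have T: "int u' * T f v' = \<sigma> * int u * T f' v' \<Longrightarrow> int u' * T f v = \<sigma> * int u * T f' v"
            by simp
          have eqz: "int u' * c f * z = \<sigma> * int u * c f' * z" using eq by simp
          have expand: "a * (b * z + d) = a * b * z + a * d" for a b d :: int
            by (simp add: algebra_simps)
          have "int u' * T f v' = \<sigma> * int u * T f' v'"
            using eq' eqz unfolding expand by linarith
          then have "int u' * (c f * z + T f v) = \<sigma> * int u * (c f' * z + T f' v)"
            unfolding expand using T eqz by linarith
          with Pr_quotient_contradiction[OF uu(1-4) _ uu(7)] uu(6) show False by blast
        qed
      qed
      then obtain w where "\<forall>f\<in>F. pat K N2 D1 (int D1 * c f * w + (c f * z + T f v'))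
          = pat K N2 D1 (c f * z + T f v)"
        unfolding D1_def by blast
      then show ?thesis by (intro exI[of _ "z + int D1 * w"]) (simp add: algebra_simps)
    qed
    then obtain z' where z': "\<forall>f\<in>F. pat K N2 D1 (c f * z' + T f v') = pat K N2 D1 (c f * z + T f v)"
      by blast
    have "pat K N D (ev m f (v(i := z))) = pat K N D (ev m f (v'(i := z')))" if "f \<in> F" for f
      unfolding upd by (rule pat_mono[OF z'[rule_format, OF that, symmetric] _ _ DD1]) (auto simp: N2_def)
    then show ?thesis using R[of "v(i := z)" "v'(i := z')"] z by blast
  qed
  moreover have "finite (F1 \<union> F2 \<union> F3)" using fin by (simp add: F1_def F2_def F3_def)
  moreover have "D' > 0" by (simp add: K'_N'_D'_def D1_def)
  ultimately show ?thesis by (intro tameI[of "F1 \<union> F2 \<union> F3" D' K' N']) blast+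
qed

section \<open>Definable relations are determined by patterns\<close>

lemma tm_val_eq_ev:
  assumes "tm_vars t \<subseteq> {..<m}"
  shows "\<exists>f. \<forall>v. tm_val int_structure v t = ev m f v"
  using assms
proof (induction t)
  case (Var i)
  have "ev m ((\<lambda>j. if j = i then 1 else 0), 0) v = v i" for v
    using Var by (simp add: ev_def if_distrib[of "\<lambda>x. x * _"] cong: if_cong)
  then show ?case by (metis tm_val.simps(1))
next
  case Zero
  show ?case by (rule exI[of _ "const_form 0"]) (simp add: int_structure_def)
next
  case One
  show ?case by (rule exI[of _ "const_form 1"]) (simp add: int_structure_def)
next
  case (Add t u)
  then obtain f g where "\<forall>v. tm_val int_structure v t = ev m f v" "\<forall>v. tm_val int_structure v u = ev m g v"
    by auto
  then show ?case by (intro exI[of _ "comb 1 f 1 g"]) (simp add: int_structure_def)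
next
  case (Minus t)
  then obtain f where "\<forall>v. tm_val int_structure v t = ev m f v" by auto
  then show ?case by (intro exI[of _ "comb (-1) f 0 f"]) (simp add: int_structure_def)
qed

lemma finite_tm_vars: "finite (tm_vars t)"
  by (induction t) auto

lemma tm_val_eventually_ev: "\<exists>m0. \<forall>m\<ge>m0. \<exists>f. \<forall>v. tm_val int_structure v t = ev m f v"
proof -
  obtain m0 where "tm_vars t \<subseteq> {..<m0}" using finite_tm_vars[of t] by (auto simp: finite_nat_set_iff_bounded)
  then have "tm_vars t \<subseteq> {..<m}" if "m \<ge> m0" for m using that by auto
  then show ?thesis using tm_val_eq_ev by blast
qed

lemma tame_atom_eventually:
  assumes "\<And>x y. pat K N D x = pat K N D y \<Longrightarrow> P x \<Longrightarrow> P y" "D > 0"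
  shows "\<exists>m0. \<forall>m\<ge>m0. tame m (\<lambda>v. P (tm_val int_structure v t))"
proof -
  obtain m0 where m0: "\<And>m. m \<ge> m0 \<Longrightarrow> \<exists>f. \<forall>v. tm_val int_structure v t = ev m f v"
    using tm_val_eventually_ev by blast
  have "tame m (\<lambda>v. P (tm_val int_structure v t))" if m: "m \<ge> m0" for m
  proof -
    obtain f where "\<forall>v. tm_val int_structure v t = ev m f v" using m0[OF m] by blast
    then show ?thesis using tame_atom[of K N D P m f, OF assms] by simp
  qed
  then show ?thesis by blast
qed

text \<open>Projection along variable \<open>i\<close> requires \<open>i < m\<close>, so
  \<open>m\<close> has to lie above the bound variables as well as the free ones. Stating the claim
  for all large \<open>m\<close> lets subformulas share a common \<open>m\<close>.\<close>

lemma sat_tame: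
  assumes Dickson: Dickson_conjecture
  shows "\<exists>m0. \<forall>m\<ge>m0. tame m (\<lambda>v. sat int_structure v \<phi>)"
proof (induction \<phi>)
  case (Eq t u)
  have "\<exists>m0. \<forall>m\<ge>m0. tame m (\<lambda>v. tm_val int_structure v (Add t (Minus u)) = 0)"
    by (rule tame_atom_eventually[of 0 0 1]) (auto simp: pat_eq_iff)
  then show ?case by (simp add: int_structure_def)
next
  case (Prime t)
  have "\<exists>m0. \<forall>m\<ge>m0. tame m (\<lambda>v. tm_val int_structure v t \<in> Pr)"
    by (rule tame_atom_eventually[of 1 0 1]) (auto simp: pat_eq_iff)
  then show ?case by (simp add: int_structure_def)
next
  case (MultPrime k t)
  have k: "k + 2 \<in> {1..k + 2}" "int (k + 2) = int k + 2" by auto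
  have "\<exists>m0. \<forall>m\<ge>m0. tame m (\<lambda>v. (\<lambda>x. (int k + 2) dvd x \<and> x div (int k + 2) \<in> Pr) (tm_val int_structure v t))"
    by (rule tame_atom_eventually[of "k + 2" 0 1]) (use k in \<open>unfold pat_eq_iff, metis\<close>, simp)
  then show ?case by (simp add: int_structure_def)
next
  case (Mult k t)
  have "\<exists>m0. \<forall>m\<ge>m0. tame m (\<lambda>v. (int k + 2) dvd tm_val int_structure v t)"
  proof (rule tame_atom_eventually[of 0 0 "k + 2"])
    show "int k + 2 dvd y" if "pat 0 0 (k + 2) x = pat 0 0 (k + 2) y" "int k + 2 dvd x" for x y
    proof -
      have "int k + 2 dvd x - y" using that(1) unfolding pat_eq_iff by (simp add: add.commute)
      then show ?thesis using that(2) by (metis dvd_diff_right_iff)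
    qed
  qed simp
  then show ?case by (simp add: int_structure_def)
next
  case (Neg \<phi>)
  then show ?case using tame_Not by fastforce
next
  case (Conj \<phi> \<psi>)
  then obtain m1 m2 where "\<forall>m\<ge>m1. tame m (\<lambda>v. sat int_structure v \<phi>)"
    "\<forall>m\<ge>m2. tame m (\<lambda>v. sat int_structure v \<psi>)" by blast
  then show ?case by (intro exI[of _ "max m1 m2"]) (simp add: tame_conj)
next
  case (Exi i \<phi>)
  then obtain m1 where "\<forall>m\<ge>m1. tame m (\<lambda>v. sat int_structure v \<phi>)" by blast
  then show ?case
    using tame_Ex[OF Dickson, of _ "\<lambda>v. sat int_structure v \<phi>" i]
    by (intro exI[of _ "max m1 (Suc i)"]) simp
qed

section \<open>Combinatorial lemmas\<close>

text \<open>The kernels of finitely many functionals, none of them zero on the module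
  \<open>V\<close>, do not cover \<open>V\<close>.\<close>

lemma generic_vector:
  fixes \<Phi> :: "((nat \<Rightarrow> int) \<Rightarrow> int) set"
  assumes "finite \<Phi>"
    and lin: "\<And>\<phi> x t y. \<phi> \<in> \<Phi> \<Longrightarrow> \<phi> (\<lambda>j. x j + t * y j) = \<phi> x + t * \<phi> y"
    and V0: "(\<lambda>_. 0) \<in> V" and V: "\<And>x t y. x \<in> V \<Longrightarrow> y \<in> V \<Longrightarrow> (\<lambda>j. x j + t * y j) \<in> V"
  shows "\<exists>v\<in>V. \<forall>\<phi>\<in>\<Phi>. \<phi> v = 0 \<longrightarrow> (\<forall>x\<in>V. \<phi> x = 0)"
  using assms(1,2)
proof (induction \<Phi> rule: finite_induct)
  case empty
  then show ?case using V0 by blast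
next
  case (insert \<phi> \<Phi>)
  then obtain v where v: "v \<in> V" "\<And>\<psi>. \<psi> \<in> \<Phi> \<Longrightarrow> \<psi> v = 0 \<Longrightarrow> \<forall>x\<in>V. \<psi> x = 0" by blast
  show ?case
  proof (cases "\<phi> v = 0 \<and> (\<exists>x\<in>V. \<phi> x \<noteq> 0)")
    case False
    then show ?thesis using v by blast
  next
    case True
    then obtain x where x: "x \<in> V" "\<phi> x \<noteq> 0" by blast
    \<comment> \<open>\<open>t\<close> exceeds every \<open>\<bar>\<psi> x\<bar>\<close>, so adding
      \<open>x\<close> cannot cancel a nonzero \<open>t * \<psi> v\<close>; and
      \<open>\<phi>\<close> takes the value \<open>\<phi> x\<close> at the new vector because
      \<open>\<phi> v = 0\<close>.\<close>
    define t where "t = (\<Sum>\<psi>\<in>\<Phi>. \<bar>\<psi> x\<bar>) + 1"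
    define v' where "v' = (\<lambda>j. x j + t * v j)"
    have "v' \<in> V" unfolding v'_def using V x v by blast
    moreover have "\<phi> v' \<noteq> 0" using insert.prems[of \<phi> x t v] True x by (simp add: v'_def)
    moreover have "\<forall>x\<in>V. \<psi> x = 0" if \<psi>: "\<psi> \<in> \<Phi>" "\<psi> v' = 0" for \<psi>
    proof (rule v(2)[OF \<psi>(1)], rule ccontr)
      assume nz: "\<psi> v \<noteq> 0"
      have "\<psi> x + t * \<psi> v = 0" using insert.prems[of \<psi> x t v] \<psi> by (simp add: v'_def)
      then have "\<bar>\<psi> x\<bar> = \<bar>t\<bar> * \<bar>\<psi> v\<bar>" by (simp add: eq_neg_iff_add_eq_0[symmetric] abs_mult)
      moreover have "\<bar>\<psi> x\<bar> < t"
        using member_le_sum[OF \<psi>(1), of "\<lambda>\<psi>. \<bar>\<psi> x\<bar>"] insert.hyps(1) by (simp add: t_def)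
      moreover have "\<bar>t\<bar> * 1 \<le> \<bar>t\<bar> * \<bar>\<psi> v\<bar>" using nz by (intro mult_left_mono) auto
      ultimately show False by linarith
    qed
    ultimately show ?thesis by blast
  qed
qed

text \<open>Averaging over all sets \<open>S\<close> of values: a quarter of them satisfy \<open>p i \<in> S\<close> and \<open>q i \<notin> S\<close>.\<close>

lemma quarter_separated:
  assumes fin: "finite J" and neq: "\<And>i. i \<in> J \<Longrightarrow> p i \<noteq> q i"
  shows "\<exists>J'\<subseteq>J. card J \<le> 4 * card J' \<and> (\<forall>i\<in>J'. \<forall>i'\<in>J'. p i \<noteq> q i')"
proof (rule ccontr)
  assume neg: "\<not> ?thesis"
  define V where "V = p ` J \<union> q ` J"
  define Z where "Z S = {i \<in> J. p i \<in> S \<and> q i \<notin> S}" for S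
  have finV: "finite V" using fin by (simp add: V_def)
  have Z: "4 * card (Z S) < card J" for S
  proof -
    have "Z S \<subseteq> J" "\<forall>i\<in>Z S. \<forall>i'\<in>Z S. p i \<noteq> q i'" by (auto simp: Z_def)
    then show ?thesis using neg by (meson not_le)
  qed
  have quarter: "card (Pow V) \<le> 4 * card {S \<in> Pow V. p i \<in> S \<and> q i \<notin> S}" if i: "i \<in> J" for i
  proof -
    let ?W = "V - {p i, q i}"
    have pq: "p i \<in> V" "q i \<in> V" "p i \<noteq> q i" using i neq by (auto simp: V_def)
    have "card V = card {p i, q i} + card ?W"
      using pq finV by (intro card_Un_disjoint[of "{p i, q i}" ?W, THEN trans[rotated]] arg_cong[of _ _ card]) auto
    then have "card V = card ?W + 2" using pq by simp
    then have 1: "card (Pow V) = 4 * card (Pow ?W)" using finV by (simp add: card_Pow power_add)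
    have "inj_on (insert (p i)) (Pow ?W)" by (rule inj_onI) blast
    then have "card (Pow ?W) = card (insert (p i) ` Pow ?W)" by (simp add: card_image)
    also have "\<dots> \<le> card {S \<in> Pow V. p i \<in> S \<and> q i \<notin> S}"
      using finV pq by (intro card_mono) auto
    finally show ?thesis using 1 by simp
  qed
  have "card J * card (Pow V) = (\<Sum>i\<in>J. card (Pow V))" by simp
  also have "\<dots> \<le> (\<Sum>i\<in>J. 4 * card {S \<in> Pow V. p i \<in> S \<and> q i \<notin> S})"
    using quarter by (rule sum_mono)
  also have "\<dots> = 4 * (\<Sum>i\<in>J. \<Sum>S\<in>Pow V. if p i \<in> S \<and> q i \<notin> S then 1 else 0)"
    using finV by (simp add: sum_distrib_left sum.If_cases Int_def conj_commute)
  also have "\<dots> = 4 * (\<Sum>S\<in>Pow V. \<Sum>i\<in>J. if p i \<in> S \<and> q i \<notin> S then 1 else 0)"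
    by (subst sum.swap) simp
  also have "\<dots> = (\<Sum>S\<in>Pow V. 4 * card (Z S))"
    using fin by (simp add: sum_distrib_left sum.If_cases Int_def Z_def)
  also have "\<dots> < (\<Sum>S\<in>Pow V. card J)"
    using finV Z by (intro sum_strict_mono) auto
  finally show False by simp
qed

text \<open>One quarter is kept for each element of \<open>C\<close>, so the loss depends on
  \<open>card C\<close> and not on the size of \<open>J\<close>.\<close>

lemma separated_subset:
  assumes "finite C" "finite J" and "\<And>c i. c \<in> C \<Longrightarrow> i \<in> J \<Longrightarrow> p c i \<noteq> q c i"
  shows "\<exists>J'\<subseteq>J. card J \<le> 4 ^ card C * card J' \<and> (\<forall>c\<in>C. \<forall>i\<in>J'. \<forall>i'\<in>J'. p c i \<noteq> q c i')"
  using assms(1,3)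
proof (induction C rule: finite_induct)
  case empty
  then show ?case by auto
next
  case (insert c C)
  then obtain J1 where J1: "J1 \<subseteq> J" "card J \<le> 4 ^ card C * card J1"
    "\<forall>c\<in>C. \<forall>i\<in>J1. \<forall>i'\<in>J1. p c i \<noteq> q c i'"
    by auto
  have "finite J1" using J1(1) assms(2) finite_subset by blast
  moreover have "p c i \<noteq> q c i" if "i \<in> J1" for i using that J1(1) insert.prems by blast
  ultimately obtain J2 where J2: "J2 \<subseteq> J1" "card J1 \<le> 4 * card J2"
    "\<forall>i\<in>J2. \<forall>i'\<in>J2. p c i \<noteq> q c i'"
    using quarter_separated[of J1 "p c" "q c"] by blast
  have "card J \<le> 4 ^ card C * (4 * card J2)"
    using J1(2) mult_le_mono2[OF J2(2)] by (rule order_trans)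
  then have "card J \<le> 4 ^ card (insert c C) * card J2" using insert.hyps by (simp add: ac_simps)
  moreover have "J2 \<subseteq> J" using J1 J2 by blast
  moreover have "\<forall>c'\<in>insert c C. \<forall>i\<in>J2. \<forall>i'\<in>J2. p c' i \<noteq> q c' i'" using J1(3) J2 by blast
  ultimately show ?case by blast
qed

lemma card_subsets_containing_pair:
  assumes "i \<noteq> i'" "i \<in> {1..n}" "i' \<in> {1..n}"
  shows "card {I. I \<subseteq> {1..n} \<and> card I = k \<and> i \<in> I \<and> i' \<in> I} \<le> (n - 2) choose (k - 2)"
proof -
  let ?B = "{1..n} - {i, i'}"
  have "{I. I \<subseteq> {1..n} \<and> card I = k \<and> i \<in> I \<and> i' \<in> I} \<subseteq> (\<lambda>J. J \<union> {i, i'}) ` {J. J \<subseteq> ?B \<and> card J = k - 2}"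
  proof
    fix I assume I: "I \<in> {I. I \<subseteq> {1..n} \<and> card I = k \<and> i \<in> I \<and> i' \<in> I}"
    then have "finite I" using finite_subset by blast
    then have "card (I - {i, i'}) = k - 2" using I assms(1) by (simp add: card_Diff_subset)
    moreover have "I = (I - {i, i'}) \<union> {i, i'}" using I by blast
    ultimately show "I \<in> (\<lambda>J. J \<union> {i, i'}) ` {J. J \<subseteq> ?B \<and> card J = k - 2}"
      using I by (intro image_eqI[of _ _ "I - {i, i'}"]) auto
  qed
  then have "card {I. I \<subseteq> {1..n} \<and> card I = k \<and> i \<in> I \<and> i' \<in> I}
      \<le> card ((\<lambda>J. J \<union> {i, i'}) ` {J. J \<subseteq> ?B \<and> card J = k - 2})"
    by (intro card_mono finite_imageI) auto
  also have "\<dots> \<le> card {J. J \<subseteq> ?B \<and> card J = k - 2}" by (intro card_image_le) auto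
  also have "\<dots> = card ?B choose (k - 2)" by (intro n_subsets) auto
  also have "card ?B = n - 2" using assms by (simp add: card_Diff_subset)
  finally show ?thesis .
qed

text \<open>
  Each \<open>I\<close> has more elements than there are colours, hence contains two of the same colour; a pair
  lies in at most \<open>(n - 2) choose (k - 2)\<close> sets.
\<close>

lemma popular_element:
  fixes \<alpha> :: real and g :: "nat set \<Rightarrow> nat \<Rightarrow> 'p"
  assumes fin: "finite \<P>" and ne: "\<P> \<noteq> {}" and k: "k = card \<P> + 1" and n: "k \<le> n" and \<alpha>: "\<alpha> > 0"
    and I: "\<And>I. I \<in> \<I> \<Longrightarrow> I \<subseteq> {1..n} \<and> card I = k"
    and g: "\<And>I i. I \<in> \<I> \<Longrightarrow> i \<in> I \<Longrightarrow> g I i \<in> \<P>"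
    and many: "real (card \<I>) \<ge> \<alpha> * real (n choose k)"
  shows "\<exists>i0\<in>{1..n}. \<exists>\<pi>\<in>\<P>. real (card {i \<in> {1..n}. \<exists>I\<in>\<I>. i \<in> I \<and> i0 \<in> I \<and> i \<noteq> i0 \<and> g I i = \<pi> \<and> g I i0 = \<pi>})
    \<ge> \<alpha> * real n / (2 * real k ^ 2 * real (card \<P>))"
proof (rule ccontr)
  assume neg: "\<not> ?thesis"
  define A where "A i0 \<pi> = {i \<in> {1..n}. \<exists>I\<in>\<I>. i \<in> I \<and> i0 \<in> I \<and> i \<noteq> i0 \<and> g I i = \<pi> \<and> g I i0 = \<pi>}" for i0 \<pi>
  define X where "X = \<alpha> * real n / (2 * real k ^ 2 * real (card \<P>))"
  define B where "B i i0 = {I. I \<subseteq> {1..n} \<and> card I = k \<and> i \<in> I \<and> i0 \<in> I}" for i i0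
  have A: "real (card (A i0 \<pi>)) < X" if "i0 \<in> {1..n}" "\<pi> \<in> \<P>" for i0 \<pi>
    using neg that unfolding A_def X_def by (meson not_le)
  have c\<P>: "card \<P> \<ge> 1" using fin ne by (simp add: Suc_le_eq card_gt_0_iff)
  define b where "b = (n - 2) choose (k - 2)"
  have "b > 0" using n by (simp add: b_def)
  have cover: "\<I> \<subseteq> (\<Union>i0\<in>{1..n}. \<Union>\<pi>\<in>\<P>. \<Union>i\<in>A i0 \<pi>. B i i0)"
  proof
    fix I assume II: "I \<in> \<I>"
    have "finite I" using I[OF II] finite_subset by blast
    have "\<not> inj_on (g I) I"
    proof
      assume "inj_on (g I) I"
      then have "card I \<le> card \<P>" using g[OF II] fin by (intro card_inj_on_le) auto
      with I[OF II] k show False by simp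
    qed
    then obtain i i0 where i: "i \<in> I" "i0 \<in> I" "i \<noteq> i0" "g I i = g I i0" unfolding inj_on_def by blast
    have "i \<in> A i0 (g I i0)" "I \<in> B i i0" "i0 \<in> {1..n}" "g I i0 \<in> \<P>"
      using i II I[OF II] g[OF II] by (auto simp: A_def B_def)
    then show "I \<in> (\<Union>i0\<in>{1..n}. \<Union>\<pi>\<in>\<P>. \<Union>i\<in>A i0 \<pi>. B i i0)" by blast
  qed
  have finA: "finite (A i0 \<pi>)" for i0 \<pi> by (simp add: A_def)
  have finB: "finite (B i i0)" for i i0
    by (rule finite_subset[of _ "Pow {1..n}"]) (auto simp: B_def)
  have cB: "card (B i i0) \<le> b" if "i \<in> A i0 \<pi>" "i0 \<in> {1..n}" for i i0 \<pi>
    unfolding B_def b_def using that by (intro card_subsets_containing_pair) (auto simp: A_def)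
  have cA: "card (\<Union>i\<in>A i0 \<pi>. B i i0) \<le> card (A i0 \<pi>) * b" if "i0 \<in> {1..n}" for i0 \<pi>
  proof -
    have "card (\<Union>i\<in>A i0 \<pi>. B i i0) \<le> (\<Sum>i\<in>A i0 \<pi>. card (B i i0))" by (rule card_UN_le[OF finA])
    also have "\<dots> \<le> (\<Sum>i\<in>A i0 \<pi>. b)" using cB that by (intro sum_mono) auto
    finally show ?thesis by simp
  qed
  have "card \<I> \<le> card (\<Union>i0\<in>{1..n}. \<Union>\<pi>\<in>\<P>. \<Union>i\<in>A i0 \<pi>. B i i0)"
    using cover fin finA finB by (intro card_mono) auto
  also have "\<dots> \<le> (\<Sum>i0\<in>{1..n}. card (\<Union>\<pi>\<in>\<P>. \<Union>i\<in>A i0 \<pi>. B i i0))" by (intro card_UN_le) simp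
  also have "\<dots> \<le> (\<Sum>i0\<in>{1..n}. \<Sum>\<pi>\<in>\<P>. card (\<Union>i\<in>A i0 \<pi>. B i i0))"
    by (intro sum_mono card_UN_le fin)
  also have "\<dots> \<le> (\<Sum>i0\<in>{1..n}. \<Sum>\<pi>\<in>\<P>. card (A i0 \<pi>) * b)"
    using cA by (intro sum_mono) auto
  finally have "real (card \<I>) \<le> real (\<Sum>i0\<in>{1..n}. \<Sum>\<pi>\<in>\<P>. card (A i0 \<pi>) * b)"
    by (rule of_nat_mono)
  also have "\<dots> = (\<Sum>i0\<in>{1..n}. \<Sum>\<pi>\<in>\<P>. real (card (A i0 \<pi>)) * real b)" by simp
  also have "\<dots> < (\<Sum>i0\<in>{1..n}. \<Sum>\<pi>\<in>\<P>. X * real b)"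
    using A fin ne n k \<open>b > 0\<close> by (intro sum_strict_mono mult_strict_right_mono) auto
  also have "\<dots> = real n * real (card \<P>) * X * real b" by simp
  also have "\<dots> = \<alpha> * (real n * real n * real b) / (2 * real k ^ 2)"
    using c\<P> by (simp add: X_def field_simps)
  \<comment> \<open>Origin of \<open>2 * k^2\<close>: double counting pairs gives
    \<open>k * (k - 1) * (n choose k) = n * (n - 1) * b\<close>, and
    \<open>n \<le> 2 * (n - 1)\<close> since \<open>n \<ge> 2\<close>.\<close>
  also have "\<dots> \<le> \<alpha> * real (n choose k)"
  proof -
    obtain n' k' where nk: "n = Suc (Suc n')" "k = Suc (Suc k')"
      using k n c\<P> by (metis Suc_le_D One_nat_def Suc_eq_plus1 Suc_le_mono)
    have "k * (n choose k) = n * (Suc n' choose Suc k')" unfolding nk by (rule Suc_times_binomial)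
    moreover have "Suc k' * (Suc n' choose Suc k') = Suc n' * b"
      unfolding b_def nk using Suc_times_binomial[of k' n'] by simp
    ultimately have "k * Suc k' * (n choose k) = n * Suc n' * b" by (metis mult.assoc mult.left_commute)
    then have e: "real k * real (Suc k') * real (n choose k) = real n * real (Suc n') * real b"
      by (metis of_nat_mult)
    have "real n * real n * real b \<le> 2 * (real n * real (Suc n') * real b)"
      unfolding nk by (simp add: algebra_simps)
    also have "\<dots> = 2 * (real k * real (Suc k') * real (n choose k))" by (simp only: e)
    also have "\<dots> \<le> 2 * (real k * real k * real (n choose k))"
      unfolding nk by (intro mult_left_mono mult_right_mono) auto
    finally have "real n * real n * real b \<le> 2 * real k ^ 2 * real (n choose k)"
      by (simp add: power2_eq_square)
    then have "\<alpha> * (real n * real n * real b) \<le> \<alpha> * (2 * real k ^ 2 * real (n choose k))"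
      using \<alpha> by (intro mult_left_mono) auto
    then show ?thesis using k by (simp add: field_simps)
  qed
  finally show False using many by simp
qed

section \<open>Fractional Helly for congruent parameters in the integers\<close>

text \<open>Counterpart of the list assignment \<open>a @ b\<close> in \<open>def_set\<close>, with
  functions in place of lists so that no lengths have to be tracked.\<close>

definition glue :: "nat \<Rightarrow> (nat \<Rightarrow> 'a) \<Rightarrow> (nat \<Rightarrow> 'a) \<Rightarrow> nat \<Rightarrow> 'a" where
  "glue r x c = (\<lambda>j. if j < r then x j else c (j - r))"

definition lpart :: "nat \<Rightarrow> form \<Rightarrow> (nat \<Rightarrow> int) \<Rightarrow> int" where
  "lpart r f x = (\<Sum>j<r. fst f j * x j)"

definition rpart :: "nat \<Rightarrow> nat \<Rightarrow> form \<Rightarrow> (nat \<Rightarrow> int) \<Rightarrow> int" where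
  "rpart r s f c = (\<Sum>j<s. fst f (r + j) * c j) + snd f"

lemma ev_glue: "ev (r + s) f (glue r x c) = lpart r f x + rpart r s f c"
proof -
  have "(\<Sum>j<r + s. h j) = (\<Sum>j<r. h j) + (\<Sum>j<s. h (r + j))" for h :: "nat \<Rightarrow> int"
    by (induction s) auto
  then show ?thesis by (simp add: ev_def glue_def lpart_def rpart_def)
qed

lemma lpart_linear: "lpart r f (\<lambda>j. x j + t * y j) = lpart r f x + t * lpart r f y"
  by (simp add: lpart_def algebra_simps sum.distrib sum_distrib_left)

lemma dvd_rpart_diff:
  assumes "\<And>j. j < s \<Longrightarrow> Q dvd c j - c' j"
  shows "Q dvd rpart r s f c - rpart r s f c'"
proof -
  have "rpart r s f c - rpart r s f c' = (\<Sum>j<s. fst f (r + j) * (c j - c' j))"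
    by (simp add: rpart_def sum_subtractf right_diff_distrib)
  also have "Q dvd \<dots>" using assms by (intro dvd_sum dvd_mult) auto
  finally show ?thesis .
qed

text \<open>A vector in the common kernel of \<open>E\<close>, generic for all combinations with
  bounded coefficients. The choice is made for all \<open>E\<close> at once because later constants
  must bound slopes along \<open>d E\<close> before the relevant \<open>E\<close> is known.\<close>

lemma exists_generic_directions:
  fixes F :: "form set" and K :: nat
  assumes "finite F"
  shows "\<exists>d. \<forall>E. (\<forall>e\<in>E. lpart r e (d E) = 0) \<and>
    (\<forall>f\<in>F. \<forall>f'\<in>F. \<forall>a\<in>{- int K..int K}. \<forall>b\<in>{- int K..int K}. \<forall>x.
      a * lpart r f (d E) = b * lpart r f' (d E) \<longrightarrow> (\<forall>e\<in>E. lpart r e x = 0) \<longrightarrow> a * lpart r f x = b * lpart r f' x)"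
proof (rule choice, rule allI)
  fix E
  define V where "V = {x. \<forall>e\<in>E. lpart r e x = 0}"
  define \<Phi> where "\<Phi> = (\<lambda>(f, f', a, b) x. a * lpart r f x - b * lpart r f' x) `
    (F \<times> F \<times> {- int K..int K} \<times> {- int K..int K})"
  have "\<exists>v\<in>V. \<forall>\<phi>\<in>\<Phi>. \<phi> v = 0 \<longrightarrow> (\<forall>x\<in>V. \<phi> x = 0)"
  proof (rule generic_vector)
    show "finite \<Phi>" using assms by (simp add: \<Phi>_def)
    show "\<phi> (\<lambda>j. x j + t * y j) = \<phi> x + t * \<phi> y" if "\<phi> \<in> \<Phi>" for \<phi> x t y
      using that by (auto simp: \<Phi>_def lpart_linear algebra_simps)
    show "(\<lambda>_. 0) \<in> V" by (simp add: V_def lpart_def)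
    show "(\<lambda>j. x j + t * y j) \<in> V" if "x \<in> V" "y \<in> V" for x t y
      using that by (simp add: V_def lpart_linear)
  qed
  then obtain v where v: "v \<in> V" "\<And>\<phi> x. \<phi> \<in> \<Phi> \<Longrightarrow> \<phi> v = 0 \<Longrightarrow> x \<in> V \<Longrightarrow> \<phi> x = 0" by blast
  have "a * lpart r f x = b * lpart r f' x"
    if "f \<in> F" "f' \<in> F" "a \<in> {- int K..int K}" "b \<in> {- int K..int K}"
      "a * lpart r f v = b * lpart r f' v" "\<forall>e\<in>E. lpart r e x = 0" for f f' a b x
  proof -
    have "(\<lambda>x. a * lpart r f x - b * lpart r f' x) \<in> \<Phi>"
      unfolding \<Phi>_def by (rule image_eqI[of _ _ "(f, f', a, b)"]) (use that in simp_all)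
    then have "a * lpart r f x - b * lpart r f' x = 0"
      by (rule v(2)) (use that in \<open>simp_all add: V_def\<close>)
    then show ?thesis by simp
  qed
  then show "\<exists>v. (\<forall>e\<in>E. lpart r e v = 0) \<and>
    (\<forall>f\<in>F. \<forall>f'\<in>F. \<forall>a\<in>{- int K..int K}. \<forall>b\<in>{- int K..int K}. \<forall>x.
      a * lpart r f v = b * lpart r f' v \<longrightarrow> (\<forall>e\<in>E. lpart r e x = 0) \<longrightarrow> a * lpart r f x = b * lpart r f' x)"
    using v(1) unfolding V_def by blast
qed

text \<open>The order of quantifiers matters: \<open>\<beta>\<close> depends on
  \<open>\<alpha>\<close> alone, whereas \<open>Q\<close> may depend on \<open>n\<close>, since
  parameters will be transferred to the integers for one \<open>n\<close> at a time.\<close>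

lemma tame_FHP:
  assumes Dickson: Dickson_conjecture and tame: "tame (r + s) R"
  shows "\<exists>k. \<forall>\<alpha>::real. \<alpha> > 0 \<longrightarrow> (\<exists>\<beta>::real. \<beta> > 0 \<and> (\<forall>n\<ge>k. \<exists>Q::nat. Q > 0 \<and>
    (\<forall>c :: nat \<Rightarrow> nat \<Rightarrow> int.
      (\<forall>i\<in>{1..n}. \<forall>i'\<in>{1..n}. \<forall>j<s. int Q dvd c i j - c i' j) \<longrightarrow>
      real (card {I. I \<subseteq> {1..n} \<and> card I = k \<and> (\<exists>x. \<forall>i\<in>I. R (glue r x (c i)))}) \<ge> \<alpha> * real (n choose k) \<longrightarrow>
      (\<exists>J\<subseteq>{1..n}. real (card J) \<ge> \<beta> * real n \<and> (\<exists>x. \<forall>i\<in>J. R (glue r x (c i)))))))"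
proof -
  obtain F K N D where fin: "finite F" and D: "D > 0"
    and R: "\<And>v v'. (\<forall>f\<in>F. pat K N D (ev (r + s) f v) = pat K N D (ev (r + s) f v')) \<Longrightarrow> R v \<Longrightarrow> R v'"
    using tame unfolding tame_def by blast
  define G where "G = lpart r"
  \<comment> \<open>The bound \<open>K + 1\<close> instead of \<open>K\<close> admits the
    coefficient 1 even if \<open>K = 0\<close>.\<close>
  obtain d where d0: "\<And>E e. e \<in> E \<Longrightarrow> G e (d E) = 0"
    and d: "\<And>E f f' a b x. f \<in> F \<Longrightarrow> f' \<in> F \<Longrightarrow> a \<in> {- int (K + 1)..int (K + 1)} \<Longrightarrow> b \<in> {- int (K + 1)..int (K + 1)} \<Longrightarrow>
      a * G f (d E) = b * G f' (d E) \<Longrightarrow> (\<forall>e\<in>E. G e x = 0) \<Longrightarrow> a * G f x = b * G f' x"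
    using exists_generic_directions[OF fin, of r "K + 1"] unfolding G_def by metis
  \<comment> \<open>The set \<open>E\<close> will depend on the parameters, whereas \<open>M\<close>
    may not; hence the sum over all subsets of \<open>F\<close>.\<close>
  define M where "M = K + D + card F + (\<Sum>E\<in>Pow F. \<Sum>f\<in>F. nat \<bar>G f (d E)\<bar>)"
  have GM: "\<bar>G f (d E)\<bar> \<le> int M" if "f \<in> F" "E \<subseteq> F" for f E
  proof -
    have "nat \<bar>G f (d E)\<bar> \<le> (\<Sum>f\<in>F. nat \<bar>G f (d E)\<bar>)"
      using member_le_sum[OF that(1), of "\<lambda>f. nat \<bar>G f (d E)\<bar>"] fin by simp
    also have "\<dots> \<le> (\<Sum>E\<in>Pow F. \<Sum>f\<in>F. nat \<bar>G f (d E)\<bar>)"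
      using member_le_sum[of E "Pow F" "\<lambda>E. \<Sum>f\<in>F. nat \<bar>G f (d E)\<bar>"] that(2) fin by simp
    finally have "nat \<bar>G f (d E)\<bar> \<le> M" unfolding M_def by linarith
    then show ?thesis by linarith
  qed
  have M: "K \<le> M" "D \<le> M" "card F \<le> M" by (auto simp: M_def)
  define N2 where "N2 = N + K * M"
  define D1 :: nat where "D1 = fact K * fact M"
  have "D dvd fact M" using D M by (intro dvd_fact) auto
  then have DD1: "D dvd D1" by (simp add: D1_def)
  have D1: "D1 > 0" by (simp add: D1_def)
  define pt where "pt = pat K N2 D1"
  define \<P> where "\<P> = PiE F (\<lambda>_. range pt)"
  define k where "k = card \<P> + 1"
  have fin\<P>: "finite \<P>" unfolding \<P>_def pt_def using fin finite_range_pat[OF D1] by (intro finite_PiE)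
  have ne\<P>: "\<P> \<noteq> {}" unfolding \<P>_def by (auto simp: PiE_eq_empty_iff)
  \<comment> \<open>All conceivable conflicts: \<open>f / u\<close> must lie in \<open>Pr\<close>,
    \<open>f' / u'\<close> must not, and they would be the same form in \<open>w\<close> up to the
    sign. Their number is independent of the parameters.\<close>
  define C where "C = F \<times> F \<times> {1..K} \<times> {1..K} \<times> {1, -1 :: int}"
  have finC: "finite C" using fin by (simp add: C_def)
  \<comment> \<open>The divisor consists of \<open>2 * k^2 * card \<P>\<close> from
    \<open>popular_element\<close> and \<open>4 ^ card C\<close> from separating indices. In the
    modulus, \<open>D1\<close> serves the residues in the patterns, and the factorial contains all
    primes up to \<open>n * card F\<close>, a bound for the total number of forms.\<close>
  have main: "\<exists>J\<subseteq>{1..n}. real (card J) \<ge> \<alpha> / (2 * real k ^ 2 * real (card \<P>) * 4 ^ card C) * real n \<and>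
      (\<exists>x. \<forall>i\<in>J. R (glue r x (c i)))"
    if \<alpha>: "\<alpha> > 0" and n: "n \<ge> k"
      and c: "\<forall>i\<in>{1..n}. \<forall>i'\<in>{1..n}. \<forall>j<s. int (D1 * fact (n * card F)) dvd c i j - c i' j"
      and many: "real (card {I. I \<subseteq> {1..n} \<and> card I = k \<and> (\<exists>x. \<forall>i\<in>I. R (glue r x (c i)))}) \<ge> \<alpha> * real (n choose k)"
    for \<alpha> :: real and n and c :: "nat \<Rightarrow> nat \<Rightarrow> int"
  proof -
    define val where "val x i f = ev (r + s) f (glue r x (c i))" for x i f
    have val: "val x i f = G f x + rpart r s f (c i)" for x i f
      by (simp add: val_def G_def ev_glue)
    define \<I> where "\<I> = {I. I \<subseteq> {1..n} \<and> card I = k \<and> (\<exists>x. \<forall>i\<in>I. R (glue r x (c i)))}"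
    define X where "X I = (SOME x. \<forall>i\<in>I. R (glue r x (c i)))" for I
    have X: "R (glue r (X I) (c i))" if "I \<in> \<I>" "i \<in> I" for I i
    proof -
      have "\<exists>x. \<forall>i\<in>I. R (glue r x (c i))" using that by (simp add: \<I>_def)
      then show ?thesis unfolding X_def using someI_ex[of "\<lambda>x. \<forall>i\<in>I. R (glue r x (c i))"] that by blast
    qed
    define g where "g I i = restrict (\<lambda>f. pt (val (X I) i f)) F" for I i
    obtain i0 \<pi> where i0: "i0 \<in> {1..n}" "\<pi> \<in> \<P>"
      and big: "real (card {i \<in> {1..n}. \<exists>I\<in>\<I>. i \<in> I \<and> i0 \<in> I \<and> i \<noteq> i0 \<and> g I i = \<pi> \<and> g I i0 = \<pi>})
        \<ge> \<alpha> * real n / (2 * real k ^ 2 * real (card \<P>))"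
      using popular_element[OF fin\<P> ne\<P> k_def n \<alpha>, of \<I> g] many
      unfolding \<I>_def[symmetric] by (auto simp: g_def \<P>_def \<I>_def)
    define J0 where "J0 = {i \<in> {1..n}. \<exists>I\<in>\<I>. i \<in> I \<and> i0 \<in> I \<and> i \<noteq> i0 \<and> g I i = \<pi> \<and> g I i0 = \<pi>}"
    have finJ0: "finite J0" by (simp add: J0_def)
    have "\<forall>i\<in>J0. \<exists>x. R (glue r x (c i)) \<and> (\<forall>f\<in>F. pt (val x i f) = \<pi> f \<and> pt (val x i0 f) = \<pi> f)"
    proof
      fix i assume "i \<in> J0"
      then obtain I where I: "I \<in> \<I>" "i \<in> I" "g I i = \<pi>" "g I i0 = \<pi>" by (auto simp: J0_def)
      have "pt (val (X I) i f) = \<pi> f \<and> pt (val (X I) i0 f) = \<pi> f" if "f \<in> F" for f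
        using fun_cong[OF I(3), of f] fun_cong[OF I(4), of f] that by (simp add: g_def)
      then show "\<exists>x. R (glue r x (c i)) \<and> (\<forall>f\<in>F. pt (val x i f) = \<pi> f \<and> pt (val x i0 f) = \<pi> f)"
        using X[OF I(1,2)] by blast
    qed
    then obtain x where x: "\<And>i. i \<in> J0 \<Longrightarrow> R (glue r (x i) (c i))"
      "\<And>i f. i \<in> J0 \<Longrightarrow> f \<in> F \<Longrightarrow> pt (val (x i) i f) = \<pi> f"
      "\<And>i f. i \<in> J0 \<Longrightarrow> f \<in> F \<Longrightarrow> pt (val (x i) i0 f) = \<pi> f"
      by metis
    have c\<P>: "real (card \<P>) > 0" using fin\<P> ne\<P> by (simp add: card_gt_0_iff)
    have "\<alpha> * real n / (2 * real k ^ 2 * real (card \<P>)) > 0"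
      using \<alpha> n k_def c\<P> by (intro divide_pos_pos mult_pos_pos) auto
    then have "J0 \<noteq> {}" using big unfolding J0_def[symmetric] by auto
    then obtain i1 where i1: "i1 \<in> J0" by blast
    define a where "a = x i1"
    \<comment> \<open>The forms whose values are fixed by the pattern; all others are made to vary along \<open>v\<close>,
      unless they are constant on the solution set of the forms in \<open>E\<close>.\<close>
    define E where "E = {f \<in> F. \<bar>val a i0 f\<bar> \<le> int N2}"
    define v where "v = d E"
    have EF: "E \<subseteq> F" by (auto simp: E_def)
    have pa: "pt (val a i0 f) = \<pi> f" if "f \<in> F" for f using x(3)[OF i1 that] by (simp add: a_def)
    have pi: "pt (val (x i) i f) = pt (val a i0 f)" if "i \<in> J0" "f \<in> F" for i f
      using x(2)[OF that] pa[OF that(2)] by simp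
    \<comment> \<open>At \<open>i0\<close> the points \<open>a\<close> and \<open>x i\<close> have
      the same pattern, hence equal values on \<open>E\<close>, where these are small.\<close>
    have kernel: "\<forall>e\<in>E. G e (\<lambda>j. a j + (-1) * x i j) = 0" if i: "i \<in> J0" for i
    proof
      fix e assume e: "e \<in> E"
      then have eF: "e \<in> F" and small: "\<bar>val a i0 e\<bar> \<le> int N2" by (auto simp: E_def)
      have 1: "val (x i) i e = val a i0 e"
        by (rule pat_eq_small[OF pi[OF i eF, symmetric, unfolded pt_def] small])
      have "pt (val a i0 e) = pt (val (x i) i0 e)" using x(3)[OF i eF] pa[OF eF] by simp
      then have 2: "val (x i) i0 e = val a i0 e"
        unfolding pt_def by (rule pat_eq_small[OF _ small])
      have "G e a = G e (x i)" using 2 unfolding val by simp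
      then show "G e (\<lambda>j. a j + (-1) * x i j) = 0"
        using lpart_linear[of r e a "-1" "x i"] by (simp add: G_def)
    qed
    \<comment> \<open>Replacing \<open>x i\<close> by \<open>a\<close> moves along a vector in the
      kernel of \<open>E\<close>; by genericity, a combination constant along \<open>v\<close> is
      constant along that vector too. Coefficients 1 and 0 cover a single form constant along
      \<open>v\<close>.\<close>
    have shift: "b * val a i f - b' * val a i f' = b * val (x i) i f - b' * val (x i) i f'"
      if "i \<in> J0" "f \<in> F" "f' \<in> F" "b \<in> {- int (K + 1)..int (K + 1)}" "b' \<in> {- int (K + 1)..int (K + 1)}"
        "b * G f v = b' * G f' v" for i f f' b b'
    proof -
      define \<delta> where "\<delta> = (\<lambda>j. a j + (-1) * x i j)"
      have \<delta>: "G h a = G h (x i) + G h \<delta>" for h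
        using lpart_linear[of r h a "-1" "x i"] by (simp add: G_def \<delta>_def)
      have "b * G f \<delta> = b' * G f' \<delta>"
        unfolding \<delta>_def by (rule d[OF that(2-5) that(6)[unfolded v_def] kernel[OF that(1)]])
      then show ?thesis unfolding val \<delta> by (simp add: algebra_simps)
    qed
    \<comment> \<open>The pairs of forms, for possibly different indices, that must not become proportional in \<open>w\<close>:
      one has to be a multiple of a prime and the other must not be.\<close>
    define act where "act = {(f, f', u, u', \<sigma>) \<in> C. int u' * G f v = \<sigma> * int u * G f' v \<and>
      (int u dvd val a i0 f \<and> val a i0 f div int u \<in> Pr) \<and>
      \<not> (int u' dvd val a i0 f' \<and> val a i0 f' div int u' \<in> Pr)}"
    define p where "p = (\<lambda>(f, f' :: form, u :: nat, u', \<sigma> :: int) i. int u' * val a i f)"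
    define q where "q = (\<lambda>(f :: form, f', u, u' :: nat, \<sigma>) i. \<sigma> * int u * val a i f')"
    have actC: "act \<subseteq> C" by (auto simp: act_def)
    have finact: "finite act" using actC finC finite_subset by blast
    \<comment> \<open>Within one index there is no conflict, because the point \<open>x i\<close>
      meets both demands; \<open>shift\<close> carries this over to the base point
      \<open>a\<close>.\<close>
    have pq: "p \<tau> i \<noteq> q \<tau> i" if \<tau>: "\<tau> \<in> act" and i: "i \<in> J0" for \<tau> i
    proof -
      obtain f f' u u' \<sigma> where t: "\<tau> = (f, f', u, u', \<sigma>)" by (metis surj_pair)
      have m: "f \<in> F" "f' \<in> F" "u \<in> {1..K}" "u' \<in> {1..K}" "\<sigma> \<in> {1, -1}"
        using \<tau> by (auto simp: t act_def C_def)
      have act: "int u' * G f v = \<sigma> * int u * G f' v"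
        "int u dvd val a i0 f \<and> val a i0 f div int u \<in> Pr"
        "\<not> (int u' dvd val a i0 f' \<and> val a i0 f' div int u' \<in> Pr)"
        using \<tau> by (auto simp: t act_def)
      have y: "int u dvd val (x i) i f \<and> val (x i) i f div int u \<in> Pr"
        using pat_eq_Pr[OF pi[OF i m(1), unfolded pt_def] m(3)] act(2) by blast
      have y': "\<not> (int u' dvd val (x i) i f' \<and> val (x i) i f' div int u' \<in> Pr)"
        using pat_eq_Pr[OF pi[OF i m(2), unfolded pt_def] m(4)] act(3) by blast
      have "int u' * val (x i) i f \<noteq> \<sigma> * int u * val (x i) i f'"
        using Pr_quotient_contradiction[OF m(3,4) _ _ y' m(5)] y by blast
      moreover have "int u' * val a i f - \<sigma> * int u * val a i f'
          = int u' * val (x i) i f - \<sigma> * int u * val (x i) i f'"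
        by (rule shift[OF i m(1,2) _ _ act(1)]) (use m in auto)
      ultimately show ?thesis by (simp add: t p_def q_def)
    qed
    have "\<exists>J\<subseteq>J0. card J0 \<le> 4 ^ card act * card J \<and>
        (\<forall>\<tau>\<in>act. \<forall>i\<in>J. \<forall>i'\<in>J. p \<tau> i \<noteq> q \<tau> i')"
      by (rule separated_subset[OF finact finJ0]) (rule pq)
    then obtain J where J: "J \<subseteq> J0" "card J0 \<le> 4 ^ card act * card J"
      "\<forall>\<tau>\<in>act. \<forall>i\<in>J. \<forall>i'\<in>J. p \<tau> i \<noteq> q \<tau> i'"
      by (elim exE conjE)
    have finJ: "finite J" by (rule finite_subset[OF J(1) finJ0])
    have Jn: "J \<subseteq> {1..n}" using J(1) by (auto simp: J0_def)
    have cQ: "int Q dvd val a i f - val a i0 f"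
      if "i \<in> J" and Q: "Q dvd D1 * fact (n * card F)" for i f and Q :: nat
    proof -
      have "int (D1 * fact (n * card F)) dvd rpart r s f (c i) - rpart r s f (c i0)"
        by (rule dvd_rpart_diff) (rule c[rule_format, OF subsetD[OF Jn that(1)] i0(1)])
      moreover have "int Q dvd int (D1 * fact (n * card F))" using Q by (simp only: int_dvd_int_iff)
      ultimately have "int Q dvd rpart r s f (c i) - rpart r s f (c i0)" by (rule dvd_trans[rotated])
      then show ?thesis unfolding val by simp
    qed
    \<comment> \<open>One application handles all indices of \<open>J\<close>: each pair
      \<open>(i, f)\<close> gives a form in \<open>w\<close> that starts from the value at
      \<open>a\<close> and has the value at \<open>x i\<close> as the model for its pattern.\<close>
    have "\<exists>w. \<forall>t\<in>J \<times> F. pat K N2 (fact K * fact M)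
        (int (fact K * fact M) * G (snd t) v * w + val a (fst t) (snd t))
      = pat K N2 (fact K * fact M) (val (x (fst t)) (fst t) (snd t))"
    proof (rule realize_patterns[OF Dickson], unfold D1_def[symmetric])
      show "finite (J \<times> F)" using finJ fin by simp
      show "K * M \<le> N2" by (simp add: N2_def)
      fix t assume t: "t \<in> J \<times> F"
      obtain i f where itf: "t = (i, f)" by (rule prod.exhaust)
      have i: "i \<in> J" "i \<in> J0" and f: "f \<in> F" using t J(1) by (auto simp: itf)
      show "pat K N2 D1 (val a (fst t) (snd t)) = pat K N2 D1 (val (x (fst t)) (fst t) (snd t))"
        if "G (snd t) v = 0"
      proof -
        have "1 * val a i f - 0 * val a i f = 1 * val (x i) i f - 0 * val (x i) i f"
          by (rule shift[OF i(2) f f]) (use that itf in auto)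
        then show ?thesis by (simp add: itf)
      qed
      \<comment> \<open>A form that moves along \<open>v\<close> lies outside \<open>E\<close>, so
        its value for \<open>i0\<close> is large, and equal patterns preserve largeness.\<close>
      show "int N2 < \<bar>val (x (fst t)) (fst t) (snd t)\<bar>" if "G (snd t) v \<noteq> 0"
      proof (rule ccontr)
        assume "\<not> ?thesis"
        then have s: "\<bar>val (x i) i f\<bar> \<le> int N2" by (simp add: itf)
        have "val a i0 f = val (x i) i f"
          by (rule pat_eq_small[OF pi[OF i(2) f, unfolded pt_def] s])
        then have "f \<in> E" using s f by (simp add: E_def)
        then show False using that d0 by (simp add: itf v_def)
      qed
      show "int D1 dvd val a (fst t) (snd t) - val (x (fst t)) (fst t) (snd t)"
      proof -
        have "int D1 dvd val a i f - val a i0 f" by (rule cQ[OF i(1)]) simp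
        moreover have "int D1 dvd val (x i) i f - val a i0 f"
          by (rule pat_eq_dvd[OF pi[OF i(2) f, unfolded pt_def]])
        ultimately have "int D1 dvd (val a i f - val a i0 f) - (val (x i) i f - val a i0 f)"
          by (rule dvd_diff)
        then show ?thesis by (simp add: itf)
      qed
    next
      fix \<rho> :: int assume \<rho>: "prime \<rho>" "int M < \<rho>"
      have nd: "\<not> \<rho> dvd int D1 * G f v" if "f \<in> F" "G f v \<noteq> 0" for f
        unfolding D1_def by (rule prime_not_dvd_fact_mult[OF \<rho> M(1) that(2)]) (use GM that(1) EF in \<open>simp add: v_def\<close>)
      obtain \<rho>' where \<rho>': "\<rho> = int \<rho>'" "prime \<rho>'" using prime_int_natD[OF \<rho>(1)] by blast
      show "\<exists>w. \<forall>t\<in>J \<times> F. G (snd t) v \<noteq> 0 \<longrightarrow>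
          \<not> \<rho> dvd int D1 * G (snd t) v * w + val a (fst t) (snd t)"
      \<comment> \<open>Modulo a prime dividing \<open>Q\<close> all indices give the same forms, so there are few roots to avoid.\<close>
      proof (cases "\<rho>' \<le> n * card F")
        case True
        define S where "S = (\<lambda>f. (int D1 * G f v, val a i0 f)) ` {f \<in> F. G f v \<noteq> 0}"
        have "card S \<le> card {f \<in> F. G f v \<noteq> 0}" unfolding S_def using fin by (intro card_image_le) auto
        also have "\<dots> \<le> card F" using fin by (intro card_mono) auto
        finally have S: "int (card S) < \<rho>" using \<rho>(2) M(3) by linarith
        have "finite S" using fin by (simp add: S_def)
        then have "\<exists>w. \<forall>(a, b) \<in> S. \<not> \<rho> dvd a * w + b"
          by (rule exists_non_root_mod_prime[OF \<rho>(1) _ S]) (use nd in \<open>unfold S_def, blast\<close>)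
        then obtain w where w: "\<forall>(a, b) \<in> S. \<not> \<rho> dvd a * w + b" by blast
        have "\<not> \<rho> dvd int D1 * G f v * w + val a i f" if "i \<in> J" "f \<in> F" "G f v \<noteq> 0" for i f
        proof
          assume d: "\<rho> dvd int D1 * G f v * w + val a i f"
          have "\<rho>' dvd fact (n * card F)" using True prime_ge_1_nat[OF \<rho>'(2)] by (intro dvd_fact)
          then have "\<rho> dvd val a i f - val a i0 f" unfolding \<rho>'(1) by (intro cQ[OF that(1)]) simp
          with d have "\<rho> dvd (int D1 * G f v * w + val a i f) - (val a i f - val a i0 f)" by (rule dvd_diff)
          then have "\<rho> dvd int D1 * G f v * w + val a i0 f" by simp
          moreover have "(int D1 * G f v, val a i0 f) \<in> S" using that unfolding S_def by blast
          ultimately show False using w by blast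
        qed
        then have "\<forall>t\<in>J \<times> F. G (snd t) v \<noteq> 0 \<longrightarrow> \<not> \<rho> dvd int D1 * G (snd t) v * w + val a (fst t) (snd t)"
          by (auto simp del: split_paired_All split_paired_Ex)
        then show ?thesis by (rule exI)
      next
        case False
        define T where "T = {t \<in> J \<times> F. G (snd t) v \<noteq> 0}"
        define h where "h t = (int D1 * G (snd t) v, val a (fst t) (snd t))" for t
        have finT: "finite T" unfolding T_def using fin finJ by simp
        have "card (h ` T) \<le> card T" by (rule card_image_le[OF finT])
        also have "\<dots> \<le> card (J \<times> F)" unfolding T_def using fin finJ by (intro card_mono) auto
        also have "\<dots> = card J * card F" by (rule card_cartesian_product)
        also have "\<dots> \<le> n * card F" using card_mono[OF _ Jn] by (intro mult_le_mono1) simp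
        finally have S: "int (card (h ` T)) < \<rho>" using False \<rho>'(1) by linarith
        have nd': "\<not> \<rho> dvd b" if "(b, b') \<in> h ` T" for b b'
        proof -
          from that obtain t where "t \<in> T" "b = int D1 * G (snd t) v" by (auto simp: h_def)
          then show ?thesis using nd[of "snd t"] by (auto simp: T_def)
        qed
        have "\<exists>w. \<forall>(a, b) \<in> h ` T. \<not> \<rho> dvd a * w + b"
          by (rule exists_non_root_mod_prime[OF \<rho>(1) finite_imageI[OF finT] S]) (rule nd')
        then obtain w where w: "\<forall>(a, b) \<in> h ` T. \<not> \<rho> dvd a * w + b" by blast
        have "\<not> \<rho> dvd int D1 * G (snd t) v * w + val a (fst t) (snd t)" if "t \<in> J \<times> F" "G (snd t) v \<noteq> 0" for t
        proof -
          have "h t \<in> h ` T" by (rule imageI) (use that in \<open>simp add: T_def\<close>)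
          from bspec[OF w this] show ?thesis by (simp add: h_def)
        qed
        then show ?thesis by blast
      qed
    next
      fix t t' u u' \<sigma>
      assume t: "t \<in> J \<times> F" "t' \<in> J \<times> F" and u: "u \<in> {1..K}" "u' \<in> {1..K}"
        and y: "int u dvd val (x (fst t)) (fst t) (snd t)" "val (x (fst t)) (fst t) (snd t) div int u \<in> Pr"
          "int u' dvd val (x (fst t')) (fst t') (snd t')" "val (x (fst t')) (fst t') (snd t') div int u' \<notin> Pr"
        and \<sigma>: "\<sigma> \<in> {1, - 1 :: int}" and eq: "int u' * G (snd t) v = \<sigma> * int u * G (snd t') v"
      obtain i f where itf1: "t = (i, f)" by (rule prod.exhaust)
      obtain i' f' where itf2: "t' = (i', f')" by (rule prod.exhaust)
      note itf = itf1 itf2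
      have i: "i \<in> J" "i' \<in> J" "i \<in> J0" "i' \<in> J0" and f: "f \<in> F" "f' \<in> F"
        using t J(1) by (auto simp: itf)
      have 1: "int u dvd val a i0 f \<and> val a i0 f div int u \<in> Pr"
        using pat_eq_Pr[OF pi[OF i(3) f(1), unfolded pt_def] u(1)] y(1,2) by (simp add: itf)
      have 2: "\<not> (int u' dvd val a i0 f' \<and> val a i0 f' div int u' \<in> Pr)"
        using pat_eq_Pr[OF pi[OF i(4) f(2), unfolded pt_def] u(2)] y(3,4) by (simp add: itf)
      have "(f, f', u, u', \<sigma>) \<in> act"
        unfolding act_def C_def using f u \<sigma> eq 1 2 by (simp add: itf)
      then have "p (f, f', u, u', \<sigma>) i \<noteq> q (f, f', u, u', \<sigma>) i'" using J(3) i by blast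
      then show "int u' * val a (fst t) (snd t) \<noteq> \<sigma> * int u * val a (fst t') (snd t')"
        by (simp add: p_def q_def itf)
    qed
    then obtain w where w: "\<And>i f. i \<in> J \<Longrightarrow> f \<in> F \<Longrightarrow>
        pat K N2 D1 (int D1 * G f v * w + val a i f) = pat K N2 D1 (val (x i) i f)"
      unfolding D1_def by force
    define z where "z = (\<lambda>j. a j + (int D1 * w) * v j)"
    have "R (glue r z (c i))" if i: "i \<in> J" for i
    proof (rule R)
      show "R (glue r (x i) (c i))" using x(1) i J(1) by blast
      show "\<forall>f\<in>F. pat K N D (ev (r + s) f (glue r (x i) (c i))) = pat K N D (ev (r + s) f (glue r z (c i)))"
      proof
        fix f assume f: "f \<in> F"
        have "val z i f = int D1 * G f v * w + val a i f"
          unfolding val z_def G_def lpart_linear by (simp add: algebra_simps)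
        then have "pat K N2 D1 (val (x i) i f) = pat K N2 D1 (val z i f)" using w[OF i f] by simp
        then have "pat K N D (val (x i) i f) = pat K N D (val z i f)"
          by (rule pat_mono[OF _ _ _ DD1]) (auto simp: N2_def)
        then show "pat K N D (ev (r + s) f (glue r (x i) (c i))) = pat K N D (ev (r + s) f (glue r z (c i)))"
          by (simp add: val_def)
      qed
    qed
    moreover have "real (card J) \<ge> \<alpha> / (2 * real k ^ 2 * real (card \<P>) * 4 ^ card C) * real n"
    proof -
      have "(4::nat) ^ card act \<le> 4 ^ card C" using card_mono[OF finC actC] by (intro power_increasing) auto
      then have "card J0 \<le> 4 ^ card C * card J" using J(2) by (meson le_trans mult_le_mono1)
      then have "real (card J0) \<le> 4 ^ card C * real (card J)"
        by (metis of_nat_le_iff of_nat_mult of_nat_power of_nat_numeral)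
      then have "\<alpha> * real n / (2 * real k ^ 2 * real (card \<P>)) \<le> 4 ^ card C * real (card J)"
        using big unfolding J0_def[symmetric] by linarith
      then have "\<alpha> * real n / (2 * real k ^ 2 * real (card \<P>)) / 4 ^ card C \<le> real (card J)"
        by (subst pos_divide_le_eq) (simp, simp only: mult.commute)
      then show ?thesis by (simp only: times_divide_eq_left divide_divide_eq_left)
    qed
    ultimately show ?thesis using Jn by blast
  qed
  have pos: "\<alpha> / (2 * real k ^ 2 * real (card \<P>) * 4 ^ card C) > 0" if "\<alpha> > 0" for \<alpha> :: real
    using that fin\<P> ne\<P> k_def by (intro divide_pos_pos mult_pos_pos) (auto simp: card_gt_0_iff)
  have Qpos: "D1 * fact (n * card F) > 0" for n :: nat using D1 by simp
  show ?thesis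
  proof (intro exI[of _ k] allI impI)
    fix \<alpha> :: real assume \<alpha>: "\<alpha> > 0"
    show "\<exists>\<beta>::real. \<beta> > 0 \<and> (\<forall>n\<ge>k. \<exists>Q::nat. Q > 0 \<and>
      (\<forall>c :: nat \<Rightarrow> nat \<Rightarrow> int.
        (\<forall>i\<in>{1..n}. \<forall>i'\<in>{1..n}. \<forall>j<s. int Q dvd c i j - c i' j) \<longrightarrow>
        real (card {I. I \<subseteq> {1..n} \<and> card I = k \<and> (\<exists>x. \<forall>i\<in>I. R (glue r x (c i)))}) \<ge> \<alpha> * real (n choose k) \<longrightarrow>
        (\<exists>J\<subseteq>{1..n}. real (card J) \<ge> \<beta> * real n \<and> (\<exists>x. \<forall>i\<in>J. R (glue r x (c i))))))"
      by (rule exI[of _ "\<alpha> / (2 * real k ^ 2 * real (card \<P>) * 4 ^ card C)"], rule conjI[OF pos[OF \<alpha>]],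
          intro allI impI, rule_tac x = "D1 * fact (n * card F)" in exI, rule conjI[OF Qpos],
          intro allI impI, rule main[OF \<alpha>])
  qed
qed

section \<open>Transfer from monster models\<close>

lemma tm_val_cong:
  "(\<And>i. i \<in> tm_vars t \<Longrightarrow> v i = w i) \<Longrightarrow> tm_val M v t = tm_val M w t"
  by (induction t) auto

lemma sat_cong:
  "(\<And>i. i \<in> free_vars \<phi> \<Longrightarrow> v i = w i) \<Longrightarrow> sat M v \<phi> = sat M w \<phi>"
proof (induction \<phi> arbitrary: v w)
  case (Exi i \<phi>)
  have "sat M (v(i := a)) \<phi> = sat M (w(i := a)) \<phi>" for a
    by (rule Exi.IH) (use Exi.prems in auto)
  then show ?case by simp
next
  case (Eq t u)
  then show ?case using tm_val_cong[of t v w M] tm_val_cong[of u v w M] by simp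
next
  case (Conj \<phi> \<psi>)
  then show ?case by (metis UnCI free_vars.simps(6) sat.simps(6))
next
  case (Prime t)
  then show ?case using tm_val_cong[of t v w M] by simp
next
  case (MultPrime k t)
  then show ?case using tm_val_cong[of t v w M] by simp
next
  case (Mult k t)
  then show ?case using tm_val_cong[of t v w M] by simp
next
  case (Neg \<phi>)
  then show ?case by (metis free_vars.simps(5) sat.simps(5))
qed

lemma finite_free_vars: "finite (free_vars \<phi>)"
  by (induction \<phi>) (auto simp: finite_tm_vars)

primrec rename_tm :: "(nat \<Rightarrow> nat) \<Rightarrow> tm \<Rightarrow> tm" where
  "rename_tm \<sigma> (Var i) = Var (\<sigma> i)"
| "rename_tm \<sigma> Zero = Zero"
| "rename_tm \<sigma> One = One"
| "rename_tm \<sigma> (Add t u) = Add (rename_tm \<sigma> t) (rename_tm \<sigma> u)"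
| "rename_tm \<sigma> (Minus t) = Minus (rename_tm \<sigma> t)"

primrec rename :: "(nat \<Rightarrow> nat) \<Rightarrow> fm \<Rightarrow> fm" where
  "rename \<sigma> (Eq t u) = Eq (rename_tm \<sigma> t) (rename_tm \<sigma> u)"
| "rename \<sigma> (Prime t) = Prime (rename_tm \<sigma> t)"
| "rename \<sigma> (MultPrime k t) = MultPrime k (rename_tm \<sigma> t)"
| "rename \<sigma> (Mult k t) = Mult k (rename_tm \<sigma> t)"
| "rename \<sigma> (Neg \<phi>) = Neg (rename \<sigma> \<phi>)"
| "rename \<sigma> (Conj \<phi> \<psi>) = Conj (rename \<sigma> \<phi>) (rename \<sigma> \<psi>)"
| "rename \<sigma> (Exi i \<phi>) = Exi (\<sigma> i) (rename \<sigma> \<phi>)"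

lemma tm_val_rename_tm [simp]: "tm_val M v (rename_tm \<sigma> t) = tm_val M (v \<circ> \<sigma>) t"
  by (induction t) auto

text \<open>Bound variables are renamed along with the free ones, so injectivity alone prevents
  capture.\<close>

lemma sat_rename:
  assumes "inj \<sigma>"
  shows "sat M v (rename \<sigma> \<phi>) = sat M (v \<circ> \<sigma>) \<phi>"
proof (induction \<phi> arbitrary: v)
  case (Exi i \<phi>)
  have "(v(\<sigma> i := a)) \<circ> \<sigma> = (v \<circ> \<sigma>)(i := a)" for a
    using assms by (auto simp: fun_eq_iff inj_eq)
  then show ?case by (simp only: rename.simps sat.simps Exi.IH)
qed auto

definition conjs :: "fm list \<Rightarrow> fm" where
  "conjs \<phi>s = foldr Conj \<phi>s (Eq Zero Zero)"

lemma sat_conjs [simp]: "sat M v (conjs \<phi>s) \<longleftrightarrow> (\<forall>\<phi>\<in>set \<phi>s. sat M v \<phi>)"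
  by (induction \<phi>s) (auto simp: conjs_def)

lemma sat_exis: "sat M v (foldr Exi is \<phi>) \<longleftrightarrow> (\<exists>w. (\<forall>i. i \<notin> set is \<longrightarrow> w i = v i) \<and> sat M w \<phi>)"
proof (induction "is" arbitrary: v)
  case Nil
  have "w = v" if "\<forall>i. w i = v i" for w using that by auto
  then show ?case by auto
next
  case (Cons i "is")
  have upd: "(\<exists>a. \<forall>j. j \<notin> set is \<longrightarrow> w j = (v(i := a)) j) \<longleftrightarrow> (\<forall>j. j \<notin> set (i # is) \<longrightarrow> w j = v j)" for w
    by (auto intro: exI[of _ "w i"])
  have "sat M v (foldr Exi (i # is) \<phi>) \<longleftrightarrow>
      (\<exists>a w. (\<forall>j. j \<notin> set is \<longrightarrow> w j = (v(i := a)) j) \<and> sat M w \<phi>)"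
    by (simp only: foldr_Cons comp_apply sat.simps Cons.IH)
  also have "\<dots> \<longleftrightarrow> (\<exists>w. (\<exists>a. \<forall>j. j \<notin> set is \<longrightarrow> w j = (v(i := a)) j) \<and> sat M w \<phi>)"
    by blast
  finally show ?case unfolding upd .
qed

lemma free_vars_exis: "free_vars (foldr Exi is \<phi>) = free_vars \<phi> - set is"
  by (induction "is") auto

text \<open>The truth values of finitely many formulas are expressed by a single sentence, the
  existential closure of a conjunction of literals. If it failed in the integers, its negation would
  belong to \<open>T_Pr\<close>.\<close>

lemma transfer_to_int:
  assumes M: "models M T_Pr" and fin: "finite \<Psi>"
  shows "\<exists>v'. \<forall>\<psi>\<in>\<Psi>. sat int_structure v' \<psi> = sat M v \<psi>"
proof -
  obtain \<psi>s where \<psi>s: "set \<psi>s = \<Psi>" using fin finite_list by blast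
  define \<chi> where "\<chi> = conjs (map (\<lambda>\<psi>. if sat M v \<psi> then \<psi> else Neg \<psi>) \<psi>s)"
  obtain "is" where "is": "set is = free_vars \<chi>" using finite_free_vars finite_list by blast
  define \<theta> where "\<theta> = foldr Exi is \<chi>"
  have closed: "free_vars \<theta> = {}" by (simp add: \<theta>_def free_vars_exis "is")
  have "sat M v (if sat M v \<psi> then \<psi> else Neg \<psi>)" for \<psi> by simp
  then have "sat M v \<chi>" unfolding \<chi>_def sat_conjs set_map by blast
  then have "sat M v \<theta>" unfolding \<theta>_def sat_exis by blast
  have "\<exists>u. sat int_structure u \<theta>"
  proof (rule ccontr)
    assume "\<not> ?thesis"
    then have "Neg \<theta> \<in> T_Pr" using closed by (simp add: T_Pr_def)
    then have "sat M v (Neg \<theta>)" using M unfolding models_def by blast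
    with \<open>sat M v \<theta>\<close> show False by simp
  qed
  then obtain v' where "sat int_structure v' \<chi>" unfolding \<theta>_def sat_exis by blast
  then have "sat int_structure v' (if sat M v \<psi> then \<psi> else Neg \<psi>)" if "\<psi> \<in> \<Psi>" for \<psi>
    using that \<psi>s unfolding \<chi>_def sat_conjs set_map by blast
  then have "sat int_structure v' \<psi> = sat M v \<psi>" if "\<psi> \<in> \<Psi>" for \<psi>
    using that by (metis sat.simps(5))
  then show ?thesis by blast
qed

section \<open>Numerals and the definability of integers\<close>

primrec nat_tm :: "nat \<Rightarrow> tm" where
  "nat_tm 0 = Zero"
| "nat_tm (Suc n) = Add One (nat_tm n)"

lemma tm_vars_nat_tm [simp]: "tm_vars (nat_tm n) = {}"
  by (induction n) auto

lemma int_structure_sel: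
  "Add_I int_structure x y = x + y" "Minus_I int_structure x = - x"
  "Mult_I int_structure k x \<longleftrightarrow> (int k + 2) dvd x"
  by (simp_all add: int_structure_def)

lemma tm_val_nat_tm_int [simp]: "tm_val int_structure v (nat_tm n) = int n"
  by (induction n) (auto simp: int_structure_def)

lemma tp_int_singleton_inject:
  assumes "tp int_structure [a] = tp int_structure [b]"
  shows "a = b"
proof -
  define t where "t = (if a \<ge> 0 then nat_tm (nat a) else Minus (nat_tm (nat (- a))))"
  have t: "tm_vars t = {}" "tm_val int_structure v t = a" for v
    by (auto simp: t_def) (simp add: int_structure_def)
  have "Eq (Var 0) t \<in> tp int_structure [a]" by (simp add: tp_def t)
  then have "Eq (Var 0) t \<in> tp int_structure [b]" using assms by simp
  then show ?thesis by (simp add: tp_def t)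
qed

text \<open>
  The \<open>i\<close>-th copy of a formula keeps the variables \<open>x\<close>, uses the \<open>i\<close>-th block of length \<open>s\<close> for \<open>y\<close>, and
  has its bound variables moved out of the way.
\<close>

definition block :: "nat \<Rightarrow> nat \<Rightarrow> nat \<Rightarrow> nat \<Rightarrow> nat \<Rightarrow> nat" where
  "block r s n i j = (if j < r then j else if j < r + s then r + i * s + (j - r) else j + (n + 1) * s)"

lemma inj_block:
  assumes "i \<le> n"
  shows "inj (block r s n i)"
proof (rule injI)
  fix j j' assume eq: "block r s n i j = block r s n i j'"
  define A B where "A = i * s" and "B = n * s"
  have "A \<le> B" unfolding A_def B_def using assms by (rule mult_le_mono1)
  then show "j = j'"
    using eq unfolding block_def add_mult_distrib A_def[symmetric] B_def[symmetric] by (auto split: if_splits)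
qed

text \<open>Says that the instances of \<open>\<phi>\<close> for the parameter blocks in
  \<open>J\<close> have a common solution \<open>x\<close>, as one formula in the concatenation of
  all blocks.\<close>

definition common_fm :: "nat \<Rightarrow> nat \<Rightarrow> nat \<Rightarrow> fm \<Rightarrow> nat set \<Rightarrow> fm" where
  "common_fm r s n \<phi> J =
    foldr Exi [0..<r] (conjs (map (\<lambda>i. rename (block r s n i) \<phi>) (sorted_list_of_set J)))"

lemma sat_common_fm:
  assumes \<phi>: "free_vars \<phi> \<subseteq> {..<r + s}" and J: "J \<subseteq> {1..n}"
  shows "sat N v (common_fm r s n \<phi> J) \<longleftrightarrow>
    (\<exists>x. \<forall>i\<in>J. sat N (glue r x (\<lambda>j. v (r + i * s + j))) \<phi>)"
proof -
  have finJ: "finite J" using J finite_subset by blast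
  have eq: "sat N w (rename (block r s n i) \<phi>) = sat N (glue r x (\<lambda>j. v (r + i * s + j))) \<phi>"
    if "i \<in> J" "\<And>j. j < r \<Longrightarrow> w j = x j" "\<And>j. j \<ge> r \<Longrightarrow> w j = v j" for w x i
  proof -
    have "inj (block r s n i)" using that(1) J by (intro inj_block) auto
    then have "sat N w (rename (block r s n i) \<phi>) = sat N (w \<circ> block r s n i) \<phi>" by (rule sat_rename)
    also have "\<dots> = sat N (glue r x (\<lambda>j. v (r + i * s + j))) \<phi>"
      by (rule sat_cong) (use \<phi> that in \<open>auto simp: glue_def block_def\<close>)
    finally show ?thesis .
  qed
  show ?thesis
  proof
    assume "sat N v (common_fm r s n \<phi> J)"
    then obtain w where w: "\<forall>i. i \<notin> {0..<r} \<longrightarrow> w i = v i" "\<forall>i\<in>J. sat N w (rename (block r s n i) \<phi>)"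
      unfolding common_fm_def sat_exis using finJ by auto
    then show "\<exists>x. \<forall>i\<in>J. sat N (glue r x (\<lambda>j. v (r + i * s + j))) \<phi>"
      using eq[of _ w w] by auto
  next
    assume "\<exists>x. \<forall>i\<in>J. sat N (glue r x (\<lambda>j. v (r + i * s + j))) \<phi>"
    then obtain x where x: "\<forall>i\<in>J. sat N (glue r x (\<lambda>j. v (r + i * s + j))) \<phi>" by blast
    define w where "w j = (if j < r then x j else v j)" for j
    have "\<forall>i\<in>J. sat N w (rename (block r s n i) \<phi>)" using x eq[of _ w x] by (auto simp: w_def)
    moreover have "\<forall>i. i \<notin> {0..<r} \<longrightarrow> w i = v i" by (simp add: w_def)
    ultimately show "sat N v (common_fm r s n \<phi> J)"
      unfolding common_fm_def sat_exis using finJ by (intro exI[of _ w]) simp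
  qed
qed

lemma Inter_def_set_nonempty_iff:
  assumes \<phi>: "free_vars \<phi> \<subseteq> {..<r + s}" and b: "\<And>i. i \<in> J \<Longrightarrow> length (b i) = s"
    and v: "\<And>i j. i \<in> J \<Longrightarrow> j < s \<Longrightarrow> v i j = b i ! j"
  shows "(\<Inter>i\<in>J. def_set N \<phi> r (b i)) \<noteq> {} \<longleftrightarrow> (\<exists>x. \<forall>i\<in>J. sat N (glue r x (v i)) \<phi>)"
proof -
  have eq: "sat N ((!) (a @ b i)) \<phi> = sat N (glue r x (v i)) \<phi>"
    if "i \<in> J" "length a = r" "\<And>j. j < r \<Longrightarrow> x j = a ! j" for i a x
    by (rule sat_cong) (use \<phi> that b v in \<open>auto simp: glue_def nth_append\<close>)
  show ?thesis
  proof
    assume "(\<Inter>i\<in>J. def_set N \<phi> r (b i)) \<noteq> {}"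
    then obtain a where a: "\<forall>i\<in>J. a \<in> def_set N \<phi> r (b i)" by blast
    then have "\<forall>i\<in>J. sat N (glue r ((!) a) (v i)) \<phi>"
      using eq[of _ a "(!) a"] by (auto simp: def_set_def)
    then show "\<exists>x. \<forall>i\<in>J. sat N (glue r x (v i)) \<phi>" by blast
  next
    assume "\<exists>x. \<forall>i\<in>J. sat N (glue r x (v i)) \<phi>"
    then obtain x where x: "\<forall>i\<in>J. sat N (glue r x (v i)) \<phi>" by blast
    then have "\<forall>i\<in>J. map x [0..<r] \<in> def_set N \<phi> r (b i)"
      using eq[of _ "map x [0..<r]" x] by (auto simp: def_set_def)
    then show "(\<Inter>i\<in>J. def_set N \<phi> r (b i)) \<noteq> {}" by blast
  qed
qed

lemma realizations_agree:
  assumes q: "q \<in> complete_types M s" and "realizes M b q" "realizes M b' q" "free_vars \<psi> \<subseteq> {..<s}"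
  shows "sat M ((!) b) \<psi> = sat M ((!) b') \<psi>"
proof -
  have "\<psi> \<in> q \<or> Neg \<psi> \<in> q" using q assms(4) unfolding complete_types_def by blast
  then show ?thesis using assms(2,3) unfolding realizes_def by (metis sat.simps(5))
qed

text \<open>Consistency of all subfamilies and the residues of all coordinates are finitely many
  formulas. A complete type decides the residue of each coordinate, so all its realisations agree on
  it, and this agreement is transferred.\<close>

lemma transfer_realizations:
  fixes M :: "'a struct" and Q :: nat
  assumes M: "models M T_Pr" and q: "q \<in> complete_types M s" and \<phi>: "free_vars \<phi> \<subseteq> {..<r + s}"
    and b: "\<And>i. i \<in> {1..n} \<Longrightarrow> length (b i) = s \<and> realizes M (b i) q" and Q: "Q > 0"
  shows "\<exists>c :: nat \<Rightarrow> nat \<Rightarrow> int.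
    (\<forall>i\<in>{1..n}. \<forall>i'\<in>{1..n}. \<forall>j. int Q dvd c i j - c i' j) \<and>
    (\<forall>J\<subseteq>{1..n}. (\<Inter>i\<in>J. def_set M \<phi> r (b i)) \<noteq> {} \<longleftrightarrow>
      (\<exists>x. \<forall>i\<in>J. sat int_structure (glue r x (c i)) \<phi>))"
proof -
  \<comment> \<open>The tuples are laid out in consecutive blocks of length \<open>s\<close>;
    positions below \<open>r\<close> may hold anything, as \<open>common_fm\<close> binds
    them.\<close>
  define v where "v l = b ((l - r) div s) ! ((l - r) mod s)" for l
  have v: "v (r + i * s + j) = b i ! j" if "j < s" for i j
    using that by (simp add: v_def add.assoc)
  \<comment> \<open>\<open>Mult k\<close> denotes divisibility by \<open>k + 2\<close>, so this is
    congruence modulo \<open>2 * Q\<close>. Doubling keeps the modulus at least 2 when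
    \<open>Q = 1\<close>.\<close>
  define residue_fm where "residue_fm l a = Mult (2 * Q - 2) (Add (Var l) (Minus (nat_tm a)))" for l a
  define \<Psi> where "\<Psi> = common_fm r s n \<phi> ` Pow {1..n} \<union>
    (\<lambda>(i, j, a). residue_fm (r + i * s + j) a) ` ({1..n} \<times> {..<s} \<times> {..<2 * Q})"
  have "finite \<Psi>" by (simp add: \<Psi>_def)
  from transfer_to_int[OF M this, of v] obtain v' where
    v': "\<And>\<psi>. \<psi> \<in> \<Psi> \<Longrightarrow> sat int_structure v' \<psi> = sat M v \<psi>" by blast
  have residue_M: "sat M v (residue_fm (r + i * s + j) a) = sat M ((!) (b i)) (residue_fm j a)"
    if "j < s" for i j a
    using that tm_val_cong[of "nat_tm a" v "(!) (b i)" M] by (simp add: residue_fm_def v)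
  have residue_int: "sat int_structure v' (residue_fm l a) \<longleftrightarrow> 2 * int Q dvd v' l - int a" for l a
  proof -
    have "int (2 * Q - 2) + 2 = 2 * int Q" using Q by linarith
    then show ?thesis
      by (simp only: residue_fm_def sat.simps tm_val.simps tm_val_nat_tm_int int_structure_sel diff_conv_add_uminus)
  qed
  \<comment> \<open>The default 0 beyond the tuple makes the congruences hold for every
    \<open>j\<close>.\<close>
  define c where "c i j = (if j < s then v' (r + i * s + j) else 0)" for i j
  have "int Q dvd c i j - c i' j" if i: "i \<in> {1..n}" "i' \<in> {1..n}" for i i' j
  proof (cases "j < s")
    case True
    define a where "a = nat (c i j mod (2 * int Q))"
    have a: "int a = c i j mod (2 * int Q)" "a < 2 * Q" using Q by (simp_all add: a_def nat_less_iff)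
    have mem: "residue_fm (r + k * s + j) a \<in> \<Psi>" if "k \<in> {1..n}" for k
      unfolding \<Psi>_def using that True a(2) by (intro UnI2 image_eqI[of _ _ "(k, j, a)"]) auto
    have fv: "free_vars (residue_fm j a) \<subseteq> {..<s}" using True by (simp add: residue_fm_def)
    have "sat int_structure v' (residue_fm (r + i * s + j) a) = sat int_structure v' (residue_fm (r + i' * s + j) a)"
      unfolding v'[OF mem[OF i(1)]] v'[OF mem[OF i(2)]] residue_M[OF True]
      by (rule realizations_agree[OF q _ _ fv]) (use b i in auto)
    then have "2 * int Q dvd c i j - int a \<longleftrightarrow> 2 * int Q dvd c i' j - int a"
      unfolding residue_int using True by (simp add: c_def)
    moreover have "2 * int Q dvd c i j - int a" unfolding a(1) by (rule dvd_minus_mod)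
    ultimately have "2 * int Q dvd (c i j - int a) - (c i' j - int a)" using dvd_diff by blast
    then have "2 * int Q dvd c i j - c i' j" by simp
    then show ?thesis by (rule dvd_mult_right)
  qed (simp add: c_def)
  moreover have "(\<Inter>i\<in>J. def_set M \<phi> r (b i)) \<noteq> {} \<longleftrightarrow>
      (\<exists>x. \<forall>i\<in>J. sat int_structure (glue r x (c i)) \<phi>)" if J: "J \<subseteq> {1..n}" for J
  proof -
    have "(\<Inter>i\<in>J. def_set M \<phi> r (b i)) \<noteq> {} \<longleftrightarrow>
        (\<exists>x. \<forall>i\<in>J. sat M (glue r x (\<lambda>j. v (r + i * s + j))) \<phi>)"
      by (rule Inter_def_set_nonempty_iff[OF \<phi>]) (use b J v in auto)
    also have "\<dots> \<longleftrightarrow> sat M v (common_fm r s n \<phi> J)" by (rule sat_common_fm[OF \<phi> J, symmetric])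
    also have "\<dots> \<longleftrightarrow> sat int_structure v' (common_fm r s n \<phi> J)"
      by (rule v'[symmetric]) (use J in \<open>auto simp: \<Psi>_def\<close>)
    also have "\<dots> \<longleftrightarrow> (\<exists>x. \<forall>i\<in>J. sat int_structure (glue r x (\<lambda>j. v' (r + i * s + j))) \<phi>)"
      by (rule sat_common_fm[OF \<phi> J])
    also have "\<dots> \<longleftrightarrow> (\<exists>x. \<forall>i\<in>J. sat int_structure (glue r x (c i)) \<phi>)"
    proof -
      have "sat int_structure (glue r x (\<lambda>j. v' (r + i * s + j))) \<phi> = sat int_structure (glue r x (c i)) \<phi>" for x i
        by (rule sat_cong) (use \<phi> in \<open>auto simp: glue_def c_def\<close>)
      then show ?thesis by simp
    qed
    finally show ?thesis .
  qed
  ultimately show ?thesis by blast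
qed

lemma locally_FHP_T_Pr:
  assumes Dickson: Dickson_conjecture
  shows "locally_FHP TYPE('a) T_Pr"
  unfolding locally_FHP_def
proof (intro allI impI)
  fix \<phi> r s assume "partitioned \<phi> r s"
  then have \<phi>: "free_vars \<phi> \<subseteq> {..<r + s}" by (simp add: partitioned_def)
  obtain m0 where m0: "\<And>m. m \<ge> m0 \<Longrightarrow> tame m (\<lambda>v. sat int_structure v \<phi>)"
    using sat_tame[OF Dickson] by blast
  \<comment> \<open>\<open>m0\<close> takes the place of \<open>s\<close> because the bound
    variables of \<open>\<phi>\<close> have to be covered; the transferred parameters are congruent
    in those positions too.\<close>
  have "tame (r + m0) (\<lambda>v. sat int_structure v \<phi>)" by (rule m0) simp
  from tame_FHP[OF Dickson this] obtain k where
    k: "\<And>\<alpha>::real. \<alpha> > 0 \<Longrightarrow> \<exists>\<beta>::real. \<beta> > 0 \<and> (\<forall>n\<ge>k. \<exists>Q::nat. Q > 0 \<and>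
      (\<forall>c :: nat \<Rightarrow> nat \<Rightarrow> int.
        (\<forall>i\<in>{1..n}. \<forall>i'\<in>{1..n}. \<forall>j<m0. int Q dvd c i j - c i' j) \<longrightarrow>
        real (card {I. I \<subseteq> {1..n} \<and> card I = k \<and> (\<exists>x. \<forall>i\<in>I. sat int_structure (glue r x (c i)) \<phi>)}) \<ge> \<alpha> * real (n choose k) \<longrightarrow>
        (\<exists>J\<subseteq>{1..n}. real (card J) \<ge> \<beta> * real n \<and> (\<exists>x. \<forall>i\<in>J. sat int_structure (glue r x (c i)) \<phi>))))"
    by blast
  have "FHP k {def_set M \<phi> r b |b. length b = s \<and> realizes M b q}"
    if MM: "monster_model T_Pr M" and q: "q \<in> complete_types M s" for M :: "'a struct" and q
    unfolding FHP_def
  proof (intro allI impI)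
    fix \<alpha> :: real assume "\<alpha> > 0"
    from k[OF this] obtain \<beta> :: real where \<beta>: "\<beta> > 0" and FHP_int: "\<And>n. n \<ge> k \<Longrightarrow> \<exists>Q::nat. Q > 0 \<and>
      (\<forall>c :: nat \<Rightarrow> nat \<Rightarrow> int.
        (\<forall>i\<in>{1..n}. \<forall>i'\<in>{1..n}. \<forall>j<m0. int Q dvd c i j - c i' j) \<longrightarrow>
        real (card {I. I \<subseteq> {1..n} \<and> card I = k \<and> (\<exists>x. \<forall>i\<in>I. sat int_structure (glue r x (c i)) \<phi>)}) \<ge> \<alpha> * real (n choose k) \<longrightarrow>
        (\<exists>J\<subseteq>{1..n}. real (card J) \<ge> \<beta> * real n \<and> (\<exists>x. \<forall>i\<in>J. sat int_structure (glue r x (c i)) \<phi>)))"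
      by blast
    have "\<exists>J\<subseteq>{1..n}. real (card J) \<ge> \<beta> * real n \<and> (\<Inter>i\<in>J. S i) \<noteq> {}"
      if n: "n \<ge> k" and S: "\<forall>i\<in>{1..n}. S i \<in> {def_set M \<phi> r b |b. length b = s \<and> realizes M b q}"
        and many: "real (card (Cons_sets k n S)) \<ge> \<alpha> * real (n choose k)" for n S
    proof -
      have "\<forall>i\<in>{1..n}. \<exists>b. S i = def_set M \<phi> r b \<and> length b = s \<and> realizes M b q" using S by blast
      then obtain b where b: "\<And>i. i \<in> {1..n} \<Longrightarrow> S i = def_set M \<phi> r (b i) \<and> length (b i) = s \<and> realizes M (b i) q"
        by metis
      have SI: "(\<Inter>i\<in>J. S i) = (\<Inter>i\<in>J. def_set M \<phi> r (b i))" if "J \<subseteq> {1..n}" for J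
        using that b by (intro INF_cong) auto
      obtain Q :: nat where Q: "Q > 0" and FHP: "\<And>c :: nat \<Rightarrow> nat \<Rightarrow> int.
        (\<forall>i\<in>{1..n}. \<forall>i'\<in>{1..n}. \<forall>j<m0. int Q dvd c i j - c i' j) \<Longrightarrow>
        real (card {I. I \<subseteq> {1..n} \<and> card I = k \<and> (\<exists>x. \<forall>i\<in>I. sat int_structure (glue r x (c i)) \<phi>)}) \<ge> \<alpha> * real (n choose k) \<Longrightarrow>
        (\<exists>J\<subseteq>{1..n}. real (card J) \<ge> \<beta> * real n \<and> (\<exists>x. \<forall>i\<in>J. sat int_structure (glue r x (c i)) \<phi>))"
        using FHP_int[OF n] by blast
      have "models M T_Pr" using MM by (simp add: monster_model_def)
      from transfer_realizations[OF this q \<phi> _ Q, of n b] b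
      obtain c :: "nat \<Rightarrow> nat \<Rightarrow> int" where
        c: "\<forall>i\<in>{1..n}. \<forall>i'\<in>{1..n}. \<forall>j. int Q dvd c i j - c i' j"
        and c_iff: "\<And>J. J \<subseteq> {1..n} \<Longrightarrow> (\<Inter>i\<in>J. def_set M \<phi> r (b i)) \<noteq> {} \<longleftrightarrow>
          (\<exists>x. \<forall>i\<in>J. sat int_structure (glue r x (c i)) \<phi>)"
        by blast
      have "Cons_sets k n S = {I. I \<subseteq> {1..n} \<and> card I = k \<and> (\<exists>x. \<forall>i\<in>I. sat int_structure (glue r x (c i)) \<phi>)}"
        unfolding Cons_sets_def using SI c_iff by (intro Collect_cong) metis
      then obtain J where J: "J \<subseteq> {1..n}" "real (card J) \<ge> \<beta> * real n"
        "\<exists>x. \<forall>i\<in>J. sat int_structure (glue r x (c i)) \<phi>"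
        using FHP[of c] c many by auto
      then have "(\<Inter>i\<in>J. S i) \<noteq> {}" using SI[OF J(1)] c_iff[OF J(1)] by simp
      with J show ?thesis by blast
    qed
    then show "\<exists>\<beta>::real. \<beta> > 0 \<and> (\<forall>n S. n \<ge> k \<longrightarrow>
        (\<forall>i\<in>{1..n}. S i \<in> {def_set M \<phi> r b |b. length b = s \<and> realizes M b q}) \<longrightarrow>
        real (card (Cons_sets k n S)) \<ge> \<alpha> * real (n choose k) \<longrightarrow>
        (\<exists>J\<subseteq>{1..n}. real (card J) \<ge> \<beta> * real n \<and> (\<Inter>i\<in>J. S i) \<noteq> {}))"
      using \<beta> by blast
  qed
  then show "\<exists>k. \<forall>M::'a struct. monster_model T_Pr M \<longrightarrow> (\<forall>q\<in>complete_types M s.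
      FHP k {def_set M \<phi> r b |b. length b = s \<and> realizes M b q})"
    by blast
qed

theorem mainTheorem7:
  assumes "Dickson_conjecture"
  shows "locally_FHP TYPE('a) T_Pr \<and>
    (\<forall>\<phi> r s. partitioned \<phi> r s \<longrightarrow>
      (\<exists>d::nat. \<forall>\<alpha>::real. \<alpha> > 0 \<longrightarrow> (\<exists>\<beta>::real. \<beta> > 0 \<and>
        (\<forall>(n::nat) (c :: nat \<Rightarrow> int list).
          (\<forall>i\<in>{1..n}. length (c i) = s)
          \<longrightarrow> (\<forall>j<s. \<forall>i\<in>{1..n}. \<forall>i'\<in>{1..n}.
                tp int_structure [c i ! j] = tp int_structure [c i' ! j])
          \<longrightarrow> real (card {I. I \<subseteq> {1..n} \<and> card I = d \<and>
                  (\<Inter>i\<in>I. def_set int_structure \<phi> r (c i)) \<noteq> {}}) \<ge> \<alpha> * real (n choose d)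
          \<longrightarrow> (\<exists>J\<subseteq>{1..n}. real (card J) \<ge> \<beta> * real n \<and>
                (\<Inter>i\<in>J. def_set int_structure \<phi> r (c i)) \<noteq> {})))))"
proof (intro conjI allI impI)
  show "locally_FHP TYPE('a) T_Pr" by (rule locally_FHP_T_Pr[OF assms])
next
  fix \<phi> r s
  \<comment> \<open>The choice is \<open>d = 1\<close> and \<open>\<beta> = 1\<close>: one nonempty
    set among identical ones makes the whole family consistent.\<close>
  have coincide: "\<exists>J\<subseteq>{1..n}. real (card J) \<ge> 1 * real n \<and> (\<Inter>i\<in>J. def_set int_structure \<phi> r (c i)) \<noteq> {}"
    if \<alpha>: "\<alpha> > 0" and len: "\<forall>i\<in>{1..n}. length (c i) = s"
      and tp: "\<forall>j<s. \<forall>i\<in>{1..n}. \<forall>i'\<in>{1..n}. tp int_structure [c i ! j] = tp int_structure [c i' ! j]"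
      and many: "real (card {I. I \<subseteq> {1..n} \<and> card I = 1 \<and> (\<Inter>i\<in>I. def_set int_structure \<phi> r (c i)) \<noteq> {}})
        \<ge> \<alpha> * real (n choose 1)" for \<alpha> :: real and n and c :: "nat \<Rightarrow> int list"
  proof (cases "n = 0")
    \<comment> \<open>With \<open>n = 0\<close> the intersection over the empty index set is the
      whole universe.\<close>
    case True
    then show ?thesis by auto
  next
    case False
    have same: "c i = c i'" if i: "i \<in> {1..n}" "i' \<in> {1..n}" for i i'
    proof (rule nth_equalityI)
      show "length (c i) = length (c i')" using len i by simp
      fix j assume "j < length (c i)"
      then have "j < s" using len i by simp
      then show "c i ! j = c i' ! j" using tp_int_singleton_inject tp i by blast
    qed
    have "0 < \<alpha> * real (n choose 1)" using \<alpha> False by simp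
    then have "card {I. I \<subseteq> {1..n} \<and> card I = 1 \<and> (\<Inter>i\<in>I. def_set int_structure \<phi> r (c i)) \<noteq> {}} \<noteq> 0"
      using many by linarith
    then have "{I. I \<subseteq> {1..n} \<and> card I = 1 \<and> (\<Inter>i\<in>I. def_set int_structure \<phi> r (c i)) \<noteq> {}} \<noteq> {}"
      by (metis card.empty)
    then obtain I where I: "I \<subseteq> {1..n}" "card I = 1" "(\<Inter>i\<in>I. def_set int_structure \<phi> r (c i)) \<noteq> {}"
      by blast
    then obtain i where i: "I = {i}" by (meson card_1_singletonE)
    then obtain a where a: "a \<in> def_set int_structure \<phi> r (c i)" using I(3) by auto
    have "a \<in> def_set int_structure \<phi> r (c i')" if "i' \<in> {1..n}" for i'
      using a same[of i i'] that I(1) i by simp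
    then have "(\<Inter>i\<in>{1..n}. def_set int_structure \<phi> r (c i)) \<noteq> {}" by blast
    then show ?thesis by (intro exI[of _ "{1..n}"]) simp
  qed
  show "\<exists>d::nat. \<forall>\<alpha>::real. \<alpha> > 0 \<longrightarrow> (\<exists>\<beta>::real. \<beta> > 0 \<and>
        (\<forall>(n::nat) (c :: nat \<Rightarrow> int list).
          (\<forall>i\<in>{1..n}. length (c i) = s)
          \<longrightarrow> (\<forall>j<s. \<forall>i\<in>{1..n}. \<forall>i'\<in>{1..n}.
                tp int_structure [c i ! j] = tp int_structure [c i' ! j])
          \<longrightarrow> real (card {I. I \<subseteq> {1..n} \<and> card I = d \<and>
                  (\<Inter>i\<in>I. def_set int_structure \<phi> r (c i)) \<noteq> {}}) \<ge> \<alpha> * real (n choose d)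
          \<longrightarrow> (\<exists>J\<subseteq>{1..n}. real (card J) \<ge> \<beta> * real n \<and>
                (\<Inter>i\<in>J. def_set int_structure \<phi> r (c i)) \<noteq> {})))"
    by (intro exI[of _ 1] allI impI conjI[OF zero_less_one], rule coincide)
qed

end
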